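(* Let $a>0$, $\gamma>1$ and $1\leq p<2$. Then there exist a set $E\subset\mathbb R$ of positive measure and a function $f_0\in L^p(\mathbb R)$ such that $$\lim_{t\to 0}P_{a,\gamma}^t f_0(x)\neq f_0(x),\quad \forall x\in E,$$ that is, for every $x\in E$ it is not the case that $P_{a,\gamma}^t f_0(x)$ converges to $f_0(x)$ as $t\to 0$, $t>0$.
   Context: The Fourier transform is $\hat f(\xi)=\int_{\mathbb R}e^{-ix\xi}f(x)\,dx$, extended to $L^p(\mathbb R)$, $1\le p\le 2$, in the usual way (Hausdorff--Young). For $a>0$, $\gamma>0$, $t>0$, the Landau type Schrödinger operator is $$P_{a,\gamma}^t f(x)=\frac{1}{2\pi}\int_{\mathbb R}\hat f(\xi)e^{ix\xi}e^{it|\xi|^a}e^{-t^\gamma|\xi|^a}\,d\xi,$$ which is an absolutely convergent integral for $f\in L^p(\mathbb R)$, $1\le p\le 2$. Functions are complex-valued. *)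

theory Defs
  imports "HOL-Analysis.Analysis" "HOL-Probability.Essential_Supremum"
begin

definition Lp_space :: "real \<Rightarrow> (real \<Rightarrow> complex) set" where
  "Lp_space p = {f \<in> borel_measurable lebesgue. integrable lebesgue (\<lambda>x. norm (f x) powr p)}"

text \<open>Convergence in \<open>L\<^sup>q\<close> norm for an exponent in \<open>[1, \<infinity>]\<close>. For finite \<open>q\<close> the \<open>q\<close>-th power of
  the norm is used, which tends to 0 iff the norm does.\<close>

definition Lp_tendsto :: "ereal \<Rightarrow> (nat \<Rightarrow> real \<Rightarrow> complex) \<Rightarrow> (real \<Rightarrow> complex) \<Rightarrow> bool" where
  "Lp_tendsto q F f \<longleftrightarrow>
    (if q = \<infinity>
     then (\<lambda>n. esssup lebesgue (\<lambda>x. ereal (norm (F n x - f x)))) \<longlonglongrightarrow> 0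
     else (\<lambda>n. \<integral>\<^sup>+x. ennreal (norm (F n x - f x) powr real_of_ereal q) \<partial>lebesgue) \<longlonglongrightarrow> 0)"

definition conjugate_exponent :: "real \<Rightarrow> ereal" where
  "conjugate_exponent p = (if p = 1 then \<infinity> else ereal (p / (p - 1)))"

definition fourier_integral :: "(real \<Rightarrow> complex) \<Rightarrow> real \<Rightarrow> complex" where
  "fourier_integral f \<xi> = (\<integral>x. exp (- (\<i> * complex_of_real x * complex_of_real \<xi>)) * f x \<partial>lebesgue)"

text \<open>The extension by density of the Fourier integral from \<open>L\<^sup>1 \<inter> L\<^sup>p\<close> to a bounded operator
  \<open>L\<^sup>p \<rightarrow> L\<^sup>p\<^sup>'\<close>, \<open>1 \<le> p \<le> 2\<close>, as a relation between \<open>f\<close> and representatives \<open>g\<close> of its transform.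
  By the Hausdorff-Young inequality every \<open>f\<close> in \<open>L\<^sup>p\<close> has such a \<open>g\<close>, it lies in \<open>L\<^sup>p\<^sup>'\<close>, it depends on
  the sequence only up to null sets, and different exponents \<open>p\<close> give the same \<open>g\<close> a.e.\<close>

definition is_fourier_Lp :: "real \<Rightarrow> (real \<Rightarrow> complex) \<Rightarrow> (real \<Rightarrow> complex) \<Rightarrow> bool" where
  "is_fourier_Lp p f g \<longleftrightarrow>
    f \<in> Lp_space p \<and> g \<in> borel_measurable lebesgue \<and>
    (\<exists>F. (\<forall>n. F n \<in> Lp_space 1 \<inter> Lp_space p) \<and>
         Lp_tendsto (ereal p) F f \<and>
         Lp_tendsto (conjugate_exponent p) (\<lambda>n. fourier_integral (F n)) g)"

text \<open>A representative of the Fourier transform, determined up to null sets; its values are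
  meaningful for \<open>f\<close> in some \<open>L\<^sup>p\<close>, \<open>1 \<le> p \<le> 2\<close>.\<close>

definition fourier_transform :: "(real \<Rightarrow> complex) \<Rightarrow> real \<Rightarrow> complex" where
  "fourier_transform f = (SOME g. \<exists>p\<in>{1..2}. is_fourier_Lp p f g)"

definition landau_schroedinger :: "real \<Rightarrow> real \<Rightarrow> real \<Rightarrow> (real \<Rightarrow> complex) \<Rightarrow> real \<Rightarrow> complex" where
  "landau_schroedinger a \<gamma> t f x =
    1 / (2 * complex_of_real pi) *
    (\<integral>\<xi>. fourier_transform f \<xi> * exp (\<i> * complex_of_real x * complex_of_real \<xi>)
          * exp (\<i> * complex_of_real (t * \<bar>\<xi>\<bar> powr a))
          * complex_of_real (exp (- (t powr \<gamma>) * \<bar>\<xi>\<bar> powr a)) \<partial>lebesgue)"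

end

theory Submission
  imports Defs "HOL-Probability.Characteristic_Functions" "HOL-Real_Asymp.Real_Asymp"
begin

text \<open>For \<open>\<gamma> > 1\<close> the damping \<open>exp (- t\<^sup>\<gamma> \<bar>\<xi>\<bar>\<^sup>a)\<close> is too weak to stop a wave packet from travelling. A packet of
frequency about \<open>N\<close> and fixed Gaussian envelope moves with the group velocity \<open>a N\<^sup>a\<^sup>-\<^sup>1\<close>, and as long as
\<open>t\<^sup>\<gamma> N\<^sup>a\<close> is small its size is almost unchanged. In this time it covers a distance that is much longer
than its wavelength. So let the data be a Gaussian times a train of very thin spikes of height 1 with period
\<open>2\<pi>/q\<close>, where \<open>1 \<ll> q \<ll> N\<close>. The spikes sit on a small set, and therefore the \<open>L\<^sup>p\<close> norm is small;
but within the short time that a spike needs to travel one period, some spike passes over every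
point of \<open>[0,1]\<close>. Hence the maximal function is bounded below on all of \<open>[0,1]\<close> although the data are as
small as desired.

Such a spike train is the average \<open>comb m N q\<close> of \<open>m\<close> modulated Gaussians with frequencies \<open>N + k q\<close>.
Its Fourier transform is an average of Gaussian densities, so no oscillatory integral has to be
estimated: the phase \<open>t \<bar>\<xi>\<bar>\<^sup>a\<close> is replaced by its tangent at \<open>N\<close>, the error is quadratic in \<open>\<xi> - N\<close>
(\<open>symbol_linearization\<close>) and is controlled by the second moment of a Gaussian (\<open>packet_transport\<close>). At a time
at which a spike passes over \<open>x\<close> all \<open>m\<close> packets have the same phase there, and they add up
(\<open>comb_focus\<close>). The bound on the \<open>L\<^sup>1\<close> norm is \<open>comb_L1_small\<close>, and \<open>focusing_function\<close> makes the scales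
compatible.

The function \<open>f\<^sub>0\<close> is a sum \<open>\<Sum> 100\<^sup>n F\<^sub>n\<close> of such data (a gliding hump). The \<open>F\<^sub>n\<close> are chosen one after the
other (\<open>focusing_sequence\<close>) with focusing times in \<open>[\<sigma>\<^sub>n, 1/(n+1)]\<close>. At these times the evolution of the earlier terms is
bounded by the sum of their weights, which is less than the contribution of the \<open>n\<close>-th term; the later
terms are chosen so small in \<open>L\<^sup>1\<close> that they do not matter at times \<open>t \<ge> \<sigma>\<^sub>n\<close>, because there the damped
propagator maps \<open>L\<^sup>1\<close> to bounded functions (\<open>evolution_L1_bound\<close>). So \<open>P\<^sup>t f\<^sub>0(x)\<close> is unbounded as \<open>t \<rightarrow> 0\<close>
for every \<open>x\<close> in \<open>[0,1]\<close>, and no limit exists.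

Since \<open>f\<^sub>0\<close> lies in \<open>L\<^sup>1\<close>, its transform in the sense of any exponent in \<open>[1,2]\<close> is given almost everywhere by the Fourier integral. That is
\<open>fourier_transform_eq_fourier_integral\<close>; it lets one compute with explicit
integrals.\<close>

section \<open>The Fourier transform of integrable functions\<close>

text \<open>The Fourier transform of the indicator of \<open>{b<..c}\<close>. Indicators of bounded intervals serve as test functions
because they lie in every \<open>L\<^sup>p\<close> and their transforms lie in every \<open>L\<^sup>q\<close> with \<open>q \<ge> 2\<close>, so they can be
paired with both kinds of convergence in the definition of the transform.\<close>

abbreviation test_kernel :: "real \<Rightarrow> real \<Rightarrow> real \<Rightarrow> complex" where
  "test_kernel b c x \<equiv> (LINT \<xi>|lborel. indicator {b<..c} \<xi> *\<^sub>R exp (- (\<i> * complex_of_real x * complex_of_real \<xi>)))"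

lemma norm_exp_neg_i [simp]: "norm (exp (- (\<i> * complex_of_real x * complex_of_real y))) = 1"
  by (simp add: norm_exp_eq_Re)

lemma tendsto_0_ennreal_le:
  fixes A B :: "'a \<Rightarrow> ennreal"
  assumes "\<And>n. A n \<le> B n" "(B \<longlongrightarrow> 0) F"
  shows "(A \<longlongrightarrow> 0) F"
  using assms by (intro tendsto_sandwich[of "\<lambda>_. 0" A F B]) auto

text \<open>Hoelder's inequality in the form that is used: a null sequence in \<open>L\<^sup>p\<close> has vanishing integrals against a
function in \<open>L\<^sup>q\<close>. Young's inequality for \<open>(u/d) (d v)\<close> gives \<open>d\<^sup>-\<^sup>p \<integral>u\<^sup>p + d\<^sup>q \<integral>v\<^sup>q\<close>; let \<open>n \<rightarrow> \<infinity>\<close>, then \<open>d \<rightarrow> 0\<close>.\<close>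

lemma Young_limit:
  fixes u :: "nat \<Rightarrow> 'a \<Rightarrow> real" and v :: "'a \<Rightarrow> real"
  assumes pq: "p > 1" "q > 1" "1/p + 1/q = 1"
    and [measurable]: "\<And>n. u n \<in> borel_measurable M" "v \<in> borel_measurable M"
    and pos: "\<And>n x. u n x \<ge> 0" "\<And>x. v x \<ge> 0"
    and u: "(\<lambda>n. \<integral>\<^sup>+x. ennreal (u n x powr p) \<partial>M) \<longlonglongrightarrow> 0"
    and v: "(\<integral>\<^sup>+x. ennreal (v x powr q) \<partial>M) < \<infinity>"
  shows "(\<lambda>n. \<integral>\<^sup>+x. ennreal (u n x * v x) \<partial>M) \<longlonglongrightarrow> 0"
proof -
  define V where "V = enn2real (\<integral>\<^sup>+x. ennreal (v x powr q) \<partial>M)"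
  have V: "(\<integral>\<^sup>+x. ennreal (v x powr q) \<partial>M) = ennreal V" "V \<ge> 0"
    using v by (auto simp: V_def)
  have bound: "(\<integral>\<^sup>+x. ennreal (u n x * v x) \<partial>M)
      \<le> ennreal (d powr (-p)) * (\<integral>\<^sup>+x. ennreal (u n x powr p) \<partial>M) + ennreal (d powr q * V)" if d: "d > 0" for d n
  proof -
    have "u n x * v x \<le> d powr (-p) * u n x powr p + d powr q * v x powr q" for x
    proof -
      have "u n x * v x = (u n x / d) * (d * v x)" using d by simp
      also have "\<dots> \<le> (u n x / d) powr p / p + (d * v x) powr q / q"
        using pq pos d by (intro Youngs_inequality) auto
      also have "\<dots> \<le> (u n x / d) powr p / 1 + (d * v x) powr q / 1"
        using pq by (intro add_mono divide_left_mono) auto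
      also have "\<dots> = d powr (-p) * u n x powr p + d powr q * v x powr q"
        using d pos by (simp add: powr_mult powr_divide powr_minus field_simps)
      finally show ?thesis .
    qed
    then have "(\<integral>\<^sup>+x. ennreal (u n x * v x) \<partial>M)
        \<le> (\<integral>\<^sup>+x. ennreal (d powr (-p)) * ennreal (u n x powr p) + ennreal (d powr q) * ennreal (v x powr q) \<partial>M)"
      by (intro nn_integral_mono) (simp add: ennreal_mult[symmetric] ennreal_plus[symmetric] ennreal_leI del: ennreal_plus)
    also have "\<dots> = ennreal (d powr (-p)) * (\<integral>\<^sup>+x. ennreal (u n x powr p) \<partial>M) + ennreal (d powr q) * ennreal V"
      by (simp add: nn_integral_add nn_integral_cmult V)
    finally show ?thesis using V(2) by (simp add: ennreal_mult[symmetric])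
  qed
  show ?thesis
  proof (rule tendsto_0_if_Limsup_eq_0_ennreal)
    have "Limsup sequentially (\<lambda>n. \<integral>\<^sup>+x. ennreal (u n x * v x) \<partial>M) \<le> ennreal (d powr q * V)" if "d > 0" for d
    proof -
      have "(\<lambda>n. ennreal (d powr (-p)) * (\<integral>\<^sup>+x. ennreal (u n x powr p) \<partial>M) + ennreal (d powr q * V))
          \<longlonglongrightarrow> ennreal (d powr (-p)) * 0 + ennreal (d powr q * V)"
        by (intro tendsto_intros tendsto_mult_ennreal u) auto
      then have "Limsup sequentially (\<lambda>n. ennreal (d powr (-p)) * (\<integral>\<^sup>+x. ennreal (u n x powr p) \<partial>M) + ennreal (d powr q * V)) = ennreal (d powr q * V)"
        by (intro lim_imp_Limsup) auto
      moreover have "Limsup sequentially (\<lambda>n. \<integral>\<^sup>+x. ennreal (u n x * v x) \<partial>M) \<le> Limsup sequentially (\<lambda>n. ennreal (d powr (-p)) * (\<integral>\<^sup>+x. ennreal (u n x powr p) \<partial>M) + ennreal (d powr q * V))"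
        by (intro Limsup_mono always_eventually allI bound that)
      ultimately show ?thesis by simp
    qed
    then have *: "eventually (\<lambda>d. Limsup sequentially (\<lambda>n. \<integral>\<^sup>+x. ennreal (u n x * v x) \<partial>M) \<le> ennreal (d powr q * V)) (at_right 0)"
      by (auto simp: eventually_at_right_field intro: exI[of _ 1])
    have lim: "((\<lambda>d. ennreal (d powr q * V)) \<longlongrightarrow> ennreal (0 * V)) (at_right 0)"
      using pq by (intro tendsto_ennrealI tendsto_mult_right tendsto_zero_powrI)
        (auto simp: eventually_at_right_field intro: exI[of _ 1] )
    have "Limsup sequentially (\<lambda>n. \<integral>\<^sup>+x. ennreal (u n x * v x) \<partial>M) \<le> ennreal (0 * V)"
      by (rule tendsto_le[OF _ lim tendsto_const *]) simp
    then show "Limsup sequentially (\<lambda>n. \<integral>\<^sup>+x. ennreal (u n x * v x) \<partial>M) = 0" by simp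
  qed
qed

text \<open>Fubini's theorem is applied on the product of two copies of \<open>lborel\<close>, which asks for a Borel
representative of a Lebesgue integrable function.\<close>

lemma integrable_borel_version:
  fixes f :: "real \<Rightarrow> complex"
  assumes f: "integrable lebesgue f"
  obtains f' where "integrable lborel f'" "f' \<in> borel_measurable borel" "AE x in lebesgue. f x = f' x"
proof -
  have [measurable]: "f \<in> borel_measurable lebesgue" using f by auto
  have "(\<lambda>x. Re (f x)) \<in> borel_measurable lebesgue" "(\<lambda>x. Im (f x)) \<in> borel_measurable lebesgue" by measurable
  from this[THEN completion_ex_borel_measurable_real]
  obtain r i where r [measurable]: "r \<in> borel_measurable lborel" "AE x in lborel. Re (f x) = r x"
    and i [measurable]: "i \<in> borel_measurable lborel" "AE x in lborel. Im (f x) = i x"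
    by blast
  define f' where "f' x = Complex (r x) (i x)" for x
  have m: "f' \<in> borel_measurable borel" 
    using r(1) i(1) unfolding f'_def Complex_eq by measurable
  have "AE x in lborel. f x = f' x"
    using r(2) i(2) by eventually_elim (auto simp: f'_def complex_eq_iff)
  then have ae: "AE x in lebesgue. f x = f' x" by (rule AE_completion)
  have ml: "f' \<in> borel_measurable lebesgue" using m by (simp add: measurable_completion)
  have "integrable lebesgue f'"
    using integrable_cong_AE[OF _ ml ae] f by simp
  then have "integrable lborel f'" using m by (simp add: integrable_completion)
  with m ae show ?thesis by (intro that) auto
qed

lemma fourier_integral_borel_version:
  assumes "f \<in> borel_measurable lebesgue" "f' \<in> borel_measurable borel" "AE x in lebesgue. f x = f' x"
  shows "fourier_integral f \<xi> = (LINT x|lborel. exp (- (\<i> * complex_of_real x * complex_of_real \<xi>)) * f' x)"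
proof -
  have [measurable]: "f \<in> borel_measurable lebesgue" "f' \<in> borel_measurable borel" 
    "(\<lambda>x. exp (- (\<i> * complex_of_real x * complex_of_real \<xi>))) \<in> borel_measurable lebesgue"
    using assms by (auto intro!: measurable_completion)
  have [measurable]: "f' \<in> borel_measurable lebesgue" by (auto intro!: measurable_completion)
  have "fourier_integral f \<xi> = (LINT x|lebesgue. exp (- (\<i> * complex_of_real x * complex_of_real \<xi>)) * f' x)"
    unfolding fourier_integral_def using assms(3) by (intro integral_cong_AE) auto
  also have "\<dots> = (LINT x|lborel. exp (- (\<i> * complex_of_real x * complex_of_real \<xi>)) * f' x)"
    by (intro integral_completion) measurable
  finally show ?thesis .
qed

lemma borel_measurable_fourier_integral:
  assumes f: "integrable lebesgue f"
  shows "fourier_integral f \<in> borel_measurable borel"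
proof -
  obtain f' where f': "integrable lborel f'" "f' \<in> borel_measurable borel" "AE x in lebesgue. f x = f' x"
    using integrable_borel_version[OF f] .
  have [measurable]: "f' \<in> borel_measurable borel" by fact
  have "fourier_integral f = (\<lambda>\<xi>. LINT x|lborel. exp (- (\<i> * complex_of_real x * complex_of_real \<xi>)) * f' x)"
    using f f' by (intro ext fourier_integral_borel_version) auto
  then show ?thesis by simp
qed

lemma norm_fourier_integral_le:
  "norm (fourier_integral f \<xi>) \<le> (LINT x|lebesgue. norm (f x))"
  unfolding fourier_integral_def
  by (rule order_trans[OF integral_norm_bound]) (simp add: norm_mult)

lemma fourier_integral_test:
  assumes f: "integrable lebesgue f"
  shows "(LINT \<xi>|lborel. indicator {b<..c} \<xi> *\<^sub>R fourier_integral f \<xi>) = (LINT x|lebesgue. f x * test_kernel b c x)"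
proof -
  obtain f' where f': "integrable lborel f'" "f' \<in> borel_measurable borel" "AE x in lebesgue. f x = f' x"
    using integrable_borel_version[OF f] .
  have [measurable]: "f' \<in> borel_measurable borel" by fact
  let ?K = "\<lambda>x \<xi>. indicator {b<..c} \<xi> *\<^sub>R (exp (- (\<i> * complex_of_real x * complex_of_real \<xi>)) * f' x)"
  have int: "integrable (lborel \<Otimes>\<^sub>M lborel) (case_prod ?K)"
  proof (rule lborel_pair.Fubini_integrable)
    show "case_prod ?K \<in> borel_measurable (lborel \<Otimes>\<^sub>M lborel)" by measurable
    have "(LINT \<xi>|lborel. norm (?K x \<xi>)) = norm (f' x) * (LINT \<xi>|lborel. indicator {b<..c} \<xi>)" for x
      by (subst integral_mult_right_zero[symmetric])
        (auto intro!: Bochner_Integration.integral_cong simp: norm_mult split: split_indicator)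
    then show "integrable lborel (\<lambda>x. LINT \<xi>|lborel. norm (case_prod ?K (x, \<xi>)))"
      using integrable_mult_left[OF integrable_norm[OF f'(1)]] by (simp only: prod.case)
    have "integrable lborel (indicator {b<..c} :: real \<Rightarrow> real)"
      by (cases "b \<le> c") auto
    note ind = this
    have "integrable lborel (\<lambda>\<xi>. indicator {b<..c} \<xi> *\<^sub>R (exp (- (\<i> * complex_of_real x * complex_of_real \<xi>)) * f' x))" for x
      by (rule Bochner_Integration.integrable_bound[where f="\<lambda>\<xi>. norm (f' x) * indicator {b<..c} \<xi>"])
        (auto simp: norm_mult ind split: split_indicator intro!: integrable_mult_right ind)
    then show "AE x in lborel. integrable lborel (\<lambda>\<xi>. case_prod ?K (x, \<xi>))" by simp
  qed
  have "(LINT \<xi>|lborel. indicator {b<..c} \<xi> *\<^sub>R fourier_integral f \<xi>)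
      = (LINT \<xi>|lborel. LINT x|lborel. ?K x \<xi>)"
    by (simp add: fourier_integral_borel_version[OF borel_measurable_integrable[OF f] f'(2,3)])
  also have "\<dots> = (LINT x|lborel. LINT \<xi>|lborel. ?K x \<xi>)"
    by (rule lborel_pair.Fubini_integral[OF int])
  also have "\<dots> = (LINT x|lborel. f' x * test_kernel b c x)"
    by (auto simp flip: integral_mult_right_zero intro!: Bochner_Integration.integral_cong)
  also have "\<dots> = (LINT x|lebesgue. f' x * test_kernel b c x)"
    by (rule integral_completion[symmetric]) measurable
  also have "\<dots> = (LINT x|lebesgue. f x * test_kernel b c x)"
  proof (rule integral_cong_AE)
    have 1: "(\<lambda>x. test_kernel b c x) \<in> borel_measurable lebesgue"
      by (intro measurable_completion) measurable
    have 2: "f' \<in> borel_measurable lebesgue" "f \<in> borel_measurable lebesgue" using f by (auto intro!: measurable_completion)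
    show "(\<lambda>x. f' x * test_kernel b c x) \<in> borel_measurable lebesgue" "(\<lambda>x. f x * test_kernel b c x) \<in> borel_measurable lebesgue"
      using 1 2 by (auto intro!: borel_measurable_times)
    show "AE x in lebesgue. f' x * test_kernel b c x = f x * test_kernel b c x" using f'(3) by auto
  qed
  finally show ?thesis .
qed

lemma norm_test_kernel_le:
  assumes "b \<le> c"
  shows "norm (test_kernel b c x) \<le> c - b"
proof -
  have "norm (test_kernel b c x) \<le> (LINT \<xi>|lborel. norm (indicator {b<..c} \<xi> *\<^sub>R exp (- (\<i> * complex_of_real x * complex_of_real \<xi>))))"
    by (rule integral_norm_bound)
  also have "\<dots> = (LINT \<xi>|lborel. indicator {b<..c} \<xi>)"
    by (intro Bochner_Integration.integral_cong) (auto split: split_indicator)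
  also have "\<dots> = c - b" using assms by simp
  finally show ?thesis .
qed

text \<open>Integrating the exponential gains a factor \<open>1/x\<close>. Together with the trivial bound by \<open>c - b\<close> this puts the
kernel into \<open>L\<^sup>q\<close> for \<open>q \<ge> 2\<close>.\<close>

lemma norm_test_kernel_decay:
  assumes "b \<le> c" "x \<noteq> 0"
  shows "norm (test_kernel b c x) \<le> 2 / \<bar>x\<bar>"
proof -
  let ?F = "\<lambda>\<xi>. \<i> / of_real x * exp (- (\<i> * complex_of_real x * complex_of_real \<xi>))"
  have "test_kernel b c x = (LINT \<xi>|lborel. indicator {b..c} \<xi> *\<^sub>R exp (- (\<i> * complex_of_real x * complex_of_real \<xi>)))"
  proof (rule integral_cong_AE)
    show "AE \<xi> in lborel. indicator {b<..c} \<xi> *\<^sub>R exp (- (\<i> * complex_of_real x * complex_of_real \<xi>)) = indicator {b..c} \<xi> *\<^sub>R exp (- (\<i> * complex_of_real x * complex_of_real \<xi>))"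
      using AE_lborel_singleton[of b] by eventually_elim (auto simp: indicator_def)
  qed measurable
  also have "\<dots> = ?F c - ?F b"
  proof (rule integral_FTC_atLeastAtMost[OF assms(1)])
    fix \<xi> :: real
    have "((\<lambda>z. \<i> / of_real x * exp (- (\<i> * complex_of_real x * z))) has_field_derivative
        exp (- (\<i> * complex_of_real x * complex_of_real \<xi>))) (at (complex_of_real \<xi>))"
      using assms(2) by (auto intro!: derivative_eq_intros)
    then show "(?F has_vector_derivative exp (- (\<i> * complex_of_real x * complex_of_real \<xi>))) (at \<xi> within {b..c})"
      by (rule has_vector_derivative_real_field)
  qed (auto intro!: continuous_intros)
  also have "norm \<dots> \<le> norm (?F c) + norm (?F b)" by (rule norm_triangle_ineq4)
  also have "\<dots> = 2 / \<bar>x\<bar>" by (simp add: norm_mult norm_divide)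
  finally show ?thesis .
qed

lemma integrable_inverse_1_plus_square: "integrable lborel (\<lambda>x::real. 1 / (1 + x^2))"
proof (rule integrableI_bounded)
  have half: "(\<integral>\<^sup>+x. ennreal (1 / (1 + x^2)) * indicator {0..} x \<partial>lborel) = ennreal (pi/2 - arctan 0)"
    by (rule nn_integral_FTC_atLeast) (auto intro!: derivative_eq_intros tendsto_arctan_at_top simp: add_nonneg_eq_0_iff field_simps)
  have "(\<integral>\<^sup>+x. ennreal (norm (1 / (1 + x^2 :: real))) \<partial>lborel)
      \<le> (\<integral>\<^sup>+x. ennreal (1 / (1 + x^2)) * indicator {0..} x + ennreal (1 / (1 + (0 + (-1) * x)^2)) * indicator {0..} (0 + (-1) * x) \<partial>lborel)"
    by (intro nn_integral_mono) (auto split: split_indicator simp: abs_of_nonneg)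
  also have "\<dots> = (\<integral>\<^sup>+x. ennreal (1 / (1 + x^2)) * indicator {0..} x \<partial>lborel)
      + (\<integral>\<^sup>+x. ennreal (1 / (1 + (0 + (-1) * x)^2)) * indicator {0..} (0 + (-1) * x) \<partial>lborel)"
    by (rule nn_integral_add) measurable
  also have "(\<integral>\<^sup>+x. ennreal (1 / (1 + (0 + (-1) * x)^2)) * indicator {0..} (0 + (-1) * x) \<partial>lborel)
      = (\<integral>\<^sup>+x. ennreal (1 / (1 + x^2)) * indicator {0..} x \<partial>lborel)"
    by (subst nn_integral_real_affine[where c="-1" and t=0]) auto
  finally show "(\<integral>\<^sup>+x. ennreal (norm (1 / (1 + x^2 :: real))) \<partial>lborel) < \<infinity>"
    by (auto simp: half intro: le_less_trans)
qed simp

lemma nn_integral_test_kernel_powr: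
  assumes "b \<le> c" "q \<ge> 2"
  shows "(\<integral>\<^sup>+x. ennreal (norm (test_kernel b c x) powr q) \<partial>lebesgue) < \<infinity>"
proof -
  define B where "B = max (c - b) 2"
  have B: "B \<ge> 2" "c - b \<le> B" by (auto simp: B_def)
  have int: "integrable lborel (\<lambda>x::real. 1 / (1 + x^2))"
    by (rule integrable_inverse_1_plus_square)
  have "norm (test_kernel b c x) powr q \<le> 2 * B powr q * (1 / (1 + x^2))" for x
  proof (cases "\<bar>x\<bar> \<le> 1")
    case True
    then have x: "x^2 \<le> 1" by (simp add: abs_square_le_1)
    have "norm (test_kernel b c x) powr q \<le> B powr q * 1"
      using norm_test_kernel_le[OF assms(1), of x] B assms by (simp add: powr_mono2)
    also have "\<dots> \<le> B powr q * (2 * (1 / (1 + x^2)))"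
      using x by (intro mult_left_mono) (auto simp: pos_le_divide_eq add_pos_nonneg)
    finally show ?thesis by (simp add: mult_ac)
  next
    case False
    then have x: "x^2 \<ge> 1" "x \<noteq> 0" by (auto simp: power2_ge_1_iff)
    have "norm (test_kernel b c x) powr q \<le> (B / \<bar>x\<bar>) powr q"
      using norm_test_kernel_decay[OF assms(1) x(2)] B assms
      by (intro powr_mono2 order_trans[OF _ divide_right_mono[OF B(1)]]) auto
    also have "\<dots> = B powr q * (1 / \<bar>x\<bar> powr q)" using B by (simp add: powr_divide)
    also have "\<dots> \<le> B powr q * (1 / \<bar>x\<bar> powr 2)"
      using assms False by (intro mult_left_mono divide_left_mono powr_mono) auto
    also have "\<dots> \<le> B powr q * (2 * (1 / (1 + x^2)))"
      using x by (intro mult_left_mono) (auto simp: field_simps powr_numeral)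
    finally show ?thesis by (simp add: mult_ac)
  qed
  then have "(\<integral>\<^sup>+x. ennreal (norm (test_kernel b c x) powr q) \<partial>lebesgue) \<le> (\<integral>\<^sup>+x. ennreal (2 * B powr q * (1 / (1 + x^2))) \<partial>lebesgue)"
    by (intro nn_integral_mono ennreal_leI)
  also have "\<dots> = (\<integral>\<^sup>+x. ennreal (2 * B powr q * (1 / (1 + x^2))) \<partial>lborel)"
    by (rule nn_integral_completion)
  also have "\<dots> = ennreal (LINT x|lborel. 2 * B powr q * (1 / (1 + x^2)))"
    by (intro nn_integral_eq_integral integrable_mult_right int) auto
  also have "\<dots> < \<infinity>" by simp
  finally show ?thesis .
qed

text \<open>Half-open intervals are an intersection-stable generator of the Borel sets. On a bounded window the
sets on which the integral vanishes form a Dynkin system, so all Borel sets belong to it.\<close>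

lemma AE_eq_0_if_interval_integrals_0:
  fixes h :: "real \<Rightarrow> complex"
  assumes meas: "h \<in> borel_measurable lebesgue"
    and int: "\<And>b c. b \<le> c \<Longrightarrow> integrable lebesgue (\<lambda>x. indicator {b<..c} x *\<^sub>R h x)"
    and zero: "\<And>b c. b \<le> c \<Longrightarrow> (LINT x|lebesgue. indicator {b<..c} x *\<^sub>R h x) = 0"
  shows "AE x in lebesgue. h x = 0"
proof -
  have loc: "AE x in lebesgue. indicator {-R<..R} x *\<^sub>R h x = 0" if R: "R \<ge> 0" for R :: real
  proof -
    define k where "k x = indicator {-R<..R} x *\<^sub>R h x" for x
    have ki: "integrable lebesgue k" unfolding k_def using R by (intro int) auto
    obtain k' where k': "integrable lborel k'" "k' \<in> borel_measurable borel" "AE x in lebesgue. k x = k' x"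
      using integrable_borel_version[OF ki] .
    have [measurable]: "k' \<in> borel_measurable borel" by fact
    have si: "set_integrable lborel A k'" if "A \<in> sets borel" for A
      using k'(1) that unfolding set_integrable_def by (intro integrable_mult_indicator) auto
    have Icc: "(LINT x:{b<..c}|lborel. k' x) = 0" for b c
    proof -
      have "(LINT x:{b<..c}|lborel. k' x) = (LINT x|lebesgue. indicator {b<..c} x *\<^sub>R k' x)"
        unfolding set_lebesgue_integral_def by (rule integral_completion[symmetric]) measurable
      also have "\<dots> = (LINT x|lebesgue. indicator {b<..c} x *\<^sub>R k x)"
      proof (rule integral_cong_AE)
        show "(\<lambda>x. indicator {b<..c} x *\<^sub>R k' x) \<in> borel_measurable lebesgue"
          by (intro measurable_completion) measurable
        have "k \<in> borel_measurable lebesgue" using ki by auto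
        then show "(\<lambda>x. indicator {b<..c} x *\<^sub>R k x) \<in> borel_measurable lebesgue"
          by (intro borel_measurable_scaleR borel_measurable_indicator) auto
        show "AE x in lebesgue. indicator {b<..c} x *\<^sub>R k' x = indicator {b<..c} x *\<^sub>R k x" using k'(3) by auto
      qed
      also have "\<dots> = (LINT x|lebesgue. indicator {max b (-R)<..min c R} x *\<^sub>R h x)"
        unfolding k_def by (intro Bochner_Integration.integral_cong) (auto split: split_indicator)
      also have "\<dots> = 0"
      proof (cases "max b (-R) \<le> min c R")
        case False
        then have "{max b (-R)<..min c R} = {}" by (intro greaterThanAtMost_empty) linarith
        then show ?thesis by (simp only: indicator_simps empty_iff scale_zero_left integral_zero not_False_eq_True)
      qed (rule zero)
      finally show ?thesis .
    qed
    let ?G = "range (\<lambda>(b,c). {b<..c::real})"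
    have "AE x in lborel. k' x = 0"
    proof (rule sigma_finite_measure.density_zero[OF lborel.sigma_finite_measure_axioms k'(1)])
      fix A assume "A \<in> sets (lborel :: real measure)"
      then have A: "A \<in> sigma_sets UNIV ?G"
        by (simp add: borel_sigma_sets_Ioc image_def)
      have *: "A \<in> sigma_sets UNIV ?G \<Longrightarrow> A \<in> sets borel" for A
        by (simp add: borel_sigma_sets_Ioc image_def)
      have tot: "(LINT x:UNIV|lborel. k' x) = 0"
      proof -
        have "(LINT x:UNIV|lborel. k' x) = (LINT x:{-R<..R}|lborel. k' x)"
          unfolding set_lebesgue_integral_def
        proof (rule integral_cong_AE)
          have "AE x in lborel. k x = k' x" using k'(3) by (simp add: AE_completion_iff)
          then show "AE x in lborel. indicator UNIV x *\<^sub>R k' x = indicator {-R<..R} x *\<^sub>R k' x"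
            by eventually_elim (auto simp: k_def split: split_indicator)
        qed measurable
        then show ?thesis using Icc by simp
      qed
      have "Int_stable ?G" unfolding Int_stable_def by auto
      moreover have "?G \<subseteq> Pow UNIV" by simp
      ultimately show "(LINT x:A|lborel. k' x) = 0"
        using A
      proof (induction rule: sigma_sets_induct_disjoint)
        case (basic A)
        then show ?case using Icc by auto
      next
        case empty
        show ?case by (simp add: set_lebesgue_integral_def)
      next
        case (compl A)
        then have [measurable]: "A \<in> sets borel" using * by blast
        have "(LINT x:UNIV|lborel. k' x) = (LINT x:(UNIV - A) \<union> A|lborel. k' x)"
          by (intro arg_cong[where f="\<lambda>B. set_lebesgue_integral lborel B k'"]) auto
        also have "\<dots> = (LINT x:UNIV - A|lborel. k' x) + (LINT x:A|lborel. k' x)"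
          by (intro set_integral_Un si) auto
        finally show ?case using compl tot by simp
      next
        case (union A)
        then have "\<And>i. A i \<in> sets borel" using * by blast
        then have "(LINT x:(\<Union>i. A i)|lborel. k' x) = (\<Sum>i. LINT x:A i|lborel. k' x)"
          using union(1) by (intro lebesgue_integral_countable_add si) (auto simp: disjoint_family_on_def)
        then show ?case using union by simp
      qed
    qed
    then have "AE x in lebesgue. k' x = 0" by (rule AE_completion)
    with k'(3) show ?thesis unfolding k_def by auto
  qed
  have "AE x in lebesgue. \<forall>n::nat. indicator {- real n<..real n} x *\<^sub>R h x = 0"
    unfolding AE_all_countable by (intro allI loc) simp
  then show ?thesis
  proof eventually_elim
    case (elim x)
    obtain n :: nat where "\<bar>x\<bar> < real n" using reals_Archimedean2 by blast
    with elim[rule_format, of n] show ?case by (auto simp: indicator_def split: if_splits)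
  qed
qed

lemma Lp_space_1_iff: "f \<in> Lp_space 1 \<longleftrightarrow> integrable lebesgue f"
  unfolding Lp_space_def by (auto simp: integrable_norm_iff)

text \<open>Over an interval, the integral of \<open>g\<close> is the limit of the integrals of the transforms of the approximating
functions \<open>F n\<close>. By Fubini these are the pairings of \<open>F n\<close> with \<open>test_kernel\<close>, and they converge to
the pairing of \<open>f\<close> with it, which is the integral of the Fourier integral of \<open>f\<close>.\<close>

lemma fourier_Lp_unique:
  assumes f: "integrable lebesgue f" and p: "p \<in> {1..2}" and g: "is_fourier_Lp p f g"
  shows "AE \<xi> in lebesgue. g \<xi> = fourier_integral f \<xi>"
proof -
  obtain F where F: "\<And>n. F n \<in> Lp_space 1 \<inter> Lp_space p"
      and Ff: "Lp_tendsto (ereal p) F f"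
      and Fg: "Lp_tendsto (conjugate_exponent p) (\<lambda>n. fourier_integral (F n)) g"
    using g unfolding is_fourier_Lp_def by blast
  have Fi: "integrable lebesgue (F n)" for n using F[of n] by (simp add: Lp_space_1_iff)
  have [measurable]: "f \<in> borel_measurable lebesgue" "g \<in> borel_measurable lebesgue"
    "\<And>n. F n \<in> borel_measurable lebesgue"
    using f g Fi by (auto simp: is_fourier_Lp_def)
  have [measurable]: "fourier_integral (F n) \<in> borel_measurable lebesgue" "fourier_integral f \<in> borel_measurable lebesgue" for n
    using borel_measurable_fourier_integral[OF Fi] borel_measurable_fourier_integral[OF f]
    by (auto intro: measurable_completion)
  have [measurable]: "test_kernel b c \<in> borel_measurable lebesgue" for b c
    by (intro measurable_completion) measurable
  have [measurable]: "(indicator {b<..c} :: real \<Rightarrow> real) \<in> borel_measurable lebesgue" for b c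
    by (intro measurable_completion) measurable
  have Ff': "(\<lambda>n. \<integral>\<^sup>+x. ennreal (norm (F n x - f x) powr p) \<partial>lebesgue) \<longlonglongrightarrow> 0"
    using Ff by (simp add: Lp_tendsto_def)
  have ind: "(\<integral>\<^sup>+\<xi>. ennreal (indicator {b<..c} \<xi>) \<partial>lebesgue) = ennreal (c - b)" if "b \<le> c" for b c :: real
    using that by (simp add: ennreal_indicator)
  have phys: "(\<lambda>n. \<integral>\<^sup>+x. ennreal (norm (F n x - f x) * norm (test_kernel b c x)) \<partial>lebesgue) \<longlonglongrightarrow> 0"
    and freq: "(\<lambda>n. \<integral>\<^sup>+\<xi>. ennreal (norm (fourier_integral (F n) \<xi> - g \<xi>) * indicator {b<..c} \<xi>) \<partial>lebesgue) \<longlonglongrightarrow> 0"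
    if bc: "b \<le> c" for b c :: real
  proof -
    have "(\<lambda>n. \<integral>\<^sup>+x. ennreal (norm (F n x - f x) * norm (test_kernel b c x)) \<partial>lebesgue) \<longlonglongrightarrow> 0 \<and>
      (\<lambda>n. \<integral>\<^sup>+\<xi>. ennreal (norm (fourier_integral (F n) \<xi> - g \<xi>) * indicator {b<..c} \<xi>) \<partial>lebesgue) \<longlonglongrightarrow> 0"
    proof (cases "p = 1")
      case True
      have "(\<lambda>n. ennreal (c - b) * (\<integral>\<^sup>+x. ennreal (norm (F n x - f x)) \<partial>lebesgue)) \<longlonglongrightarrow> ennreal (c - b) * 0"
        using Ff' True by (intro tendsto_mult_ennreal tendsto_const) auto
      moreover have "(\<integral>\<^sup>+x. ennreal (norm (F n x - f x) * norm (test_kernel b c x)) \<partial>lebesgue)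
          \<le> ennreal (c - b) * (\<integral>\<^sup>+x. ennreal (norm (F n x - f x)) \<partial>lebesgue)" for n
      proof -
        have "(\<integral>\<^sup>+x. ennreal (norm (F n x - f x) * norm (test_kernel b c x)) \<partial>lebesgue)
            \<le> (\<integral>\<^sup>+x. ennreal (c - b) * ennreal (norm (F n x - f x)) \<partial>lebesgue)"
          using norm_test_kernel_le[OF bc] bc
          by (intro nn_integral_mono) (auto simp: ennreal_mult[symmetric] mult.commute[of "c - b"] intro!: ennreal_leI mult_left_mono)
        then show ?thesis by (simp add: nn_integral_cmult)
      qed
      ultimately have 1: "(\<lambda>n. \<integral>\<^sup>+x. ennreal (norm (F n x - f x) * norm (test_kernel b c x)) \<partial>lebesgue) \<longlonglongrightarrow> 0"
        by (metis (no_types, lifting) mult_zero_right tendsto_0_ennreal_le)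
      define e where "e n = esssup lebesgue (\<lambda>\<xi>. ereal (norm (fourier_integral (F n) \<xi> - g \<xi>)))" for n
      have "e \<longlonglongrightarrow> 0" using Fg True by (simp add: Lp_tendsto_def conjugate_exponent_def e_def[abs_def])
      then have "(\<lambda>n. e2ennreal (e n) * ennreal (c - b)) \<longlonglongrightarrow> e2ennreal 0 * ennreal (c - b)"
        by (intro tendsto_mult_ennreal tendsto_const tendsto_e2ennrealI) (auto simp: e2ennreal_neg)
      moreover have "(\<integral>\<^sup>+\<xi>. ennreal (norm (fourier_integral (F n) \<xi> - g \<xi>) * indicator {b<..c} \<xi>) \<partial>lebesgue)
          \<le> e2ennreal (e n) * ennreal (c - b)" for n
      proof -
        have "AE \<xi> in lebesgue. ereal (norm (fourier_integral (F n) \<xi> - g \<xi>)) \<le> e n"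
          unfolding e_def by (rule esssup_AE)
        then have "(\<integral>\<^sup>+\<xi>. ennreal (norm (fourier_integral (F n) \<xi> - g \<xi>) * indicator {b<..c} \<xi>) \<partial>lebesgue)
            \<le> (\<integral>\<^sup>+\<xi>. e2ennreal (e n) * ennreal (indicator {b<..c} \<xi>) \<partial>lebesgue)"
          by (intro nn_integral_mono_AE, eventually_elim)
            (auto split: split_indicator dest: e2ennreal_mono simp: e2ennreal_ereal)
        also have "\<dots> = e2ennreal (e n) * (\<integral>\<^sup>+\<xi>. ennreal (indicator {b<..c} \<xi>) \<partial>lebesgue)"
          by (intro nn_integral_cmult measurable_completion) measurable
        finally show ?thesis by (simp only: ind[OF bc])
      qed
      ultimately have 2: "(\<lambda>n. \<integral>\<^sup>+\<xi>. ennreal (norm (fourier_integral (F n) \<xi> - g \<xi>) * indicator {b<..c} \<xi>) \<partial>lebesgue) \<longlonglongrightarrow> 0"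
        by (metis (no_types, lifting) mult_zero_left e2ennreal_neg[OF order_refl] tendsto_0_ennreal_le)
      from 1 2 show ?thesis ..
    next
      case False
      define q where "q = p / (p - 1)"
      have pq: "p > 1" "q > 1" "1/p + 1/q = 1" "1/q + 1/p = 1" "q \<ge> 2"
        using p False by (auto simp: q_def field_simps)
      have Fg': "(\<lambda>n. \<integral>\<^sup>+x. ennreal (norm (fourier_integral (F n) x - g x) powr q) \<partial>lebesgue) \<longlonglongrightarrow> 0"
        using Fg False by (simp add: Lp_tendsto_def conjugate_exponent_def q_def)
      have ip: "indicator {b<..c} \<xi> powr p = (indicator {b<..c} \<xi> :: real)" for \<xi>
        by (auto split: split_indicator)
      show ?thesis
      proof
        show "(\<lambda>n. \<integral>\<^sup>+x. ennreal (norm (F n x - f x) * norm (test_kernel b c x)) \<partial>lebesgue) \<longlonglongrightarrow> 0"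
          using nn_integral_test_kernel_powr[OF bc pq(5)] by (intro Young_limit[OF pq(1-3)] Ff') auto
        show "(\<lambda>n. \<integral>\<^sup>+\<xi>. ennreal (norm (fourier_integral (F n) \<xi> - g \<xi>) * indicator {b<..c} \<xi>) \<partial>lebesgue) \<longlonglongrightarrow> 0"
          by (rule Young_limit[OF pq(2,1,4) _ _ _ _ Fg']) (auto simp: ind[OF bc] ip)
      qed
    qed
    then show "(\<lambda>n. \<integral>\<^sup>+x. ennreal (norm (F n x - f x) * norm (test_kernel b c x)) \<partial>lebesgue) \<longlonglongrightarrow> 0"
      and "(\<lambda>n. \<integral>\<^sup>+\<xi>. ennreal (norm (fourier_integral (F n) \<xi> - g \<xi>) * indicator {b<..c} \<xi>) \<partial>lebesgue) \<longlonglongrightarrow> 0"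
      by auto
  qed
  have trunc: "integrable lebesgue (\<lambda>\<xi>. indicator {b<..c} \<xi> *\<^sub>R fourier_integral k \<xi>)"
    if k: "integrable lebesgue k" for k and b c :: real
  proof (rule Bochner_Integration.integrable_bound[where f="\<lambda>\<xi>. indicator {b<..c} \<xi> * (LINT x|lebesgue. norm (k x))"])
    show "integrable lebesgue (\<lambda>\<xi>. indicator {b<..c} \<xi> * (LINT x|lebesgue. norm (k x)))"
      by (cases "b \<le> c") auto
    have [measurable]: "fourier_integral k \<in> borel_measurable lebesgue"
      using borel_measurable_fourier_integral[OF k] by (auto intro: measurable_completion)
    show "(\<lambda>\<xi>. indicator {b<..c} \<xi> *\<^sub>R fourier_integral k \<xi>) \<in> borel_measurable lebesgue" by measurable
    have "norm (fourier_integral k \<xi>) \<le> \<bar>LINT x|lebesgue. norm (k x)\<bar>" for \<xi>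
      using norm_fourier_integral_le[of k \<xi>] by linarith
    then show "AE \<xi> in lebesgue. norm (indicator {b<..c} \<xi> *\<^sub>R fourier_integral k \<xi>) \<le> norm (indicator {b<..c} \<xi> * (LINT x|lebesgue. norm (k x)))"
      by (auto split: split_indicator)
  qed
  \<comment> \<open>Nothing is known yet about the local integrability of \<open>g\<close>; it follows from the integral distance
      to the bounded functions \<open>fourier_integral (F n)\<close>, which is finite for large \<open>n\<close>.\<close>
  have diff_int: "\<exists>n0. \<forall>n\<ge>n0. integrable lebesgue (\<lambda>\<xi>. indicator {b<..c} \<xi> *\<^sub>R (fourier_integral (F n) \<xi> - g \<xi>))"
    if bc: "b \<le> c" for b c :: real
  proof -
    have "eventually (\<lambda>n. (\<integral>\<^sup>+\<xi>. ennreal (norm (fourier_integral (F n) \<xi> - g \<xi>) * indicator {b<..c} \<xi>) \<partial>lebesgue) < 1) sequentially"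
      using freq[OF bc] by (rule order_tendstoD) simp
    then obtain n0 where n0: "\<And>n. n \<ge> n0 \<Longrightarrow> (\<integral>\<^sup>+\<xi>. ennreal (norm (fourier_integral (F n) \<xi> - g \<xi>) * indicator {b<..c} \<xi>) \<partial>lebesgue) < 1"
      by (auto simp: eventually_sequentially)
    have "integrable lebesgue (\<lambda>\<xi>. indicator {b<..c} \<xi> *\<^sub>R (fourier_integral (F n) \<xi> - g \<xi>))" if "n \<ge> n0" for n
      using n0[OF that] by (intro integrableI_bounded) (auto simp: mult.commute intro: less_trans)
    then show ?thesis by blast
  qed
  have "AE \<xi> in lebesgue. g \<xi> - fourier_integral f \<xi> = 0"
  proof (rule AE_eq_0_if_interval_integrals_0)
    show "(\<lambda>\<xi>. g \<xi> - fourier_integral f \<xi>) \<in> borel_measurable lebesgue" by measurable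
    fix b c :: real assume bc: "b \<le> c"
    let ?I = "\<lambda>\<xi>. indicator {b<..c} \<xi> :: real"
    obtain n0 where n0: "\<And>n. n \<ge> n0 \<Longrightarrow> integrable lebesgue (\<lambda>\<xi>. ?I \<xi> *\<^sub>R (fourier_integral (F n) \<xi> - g \<xi>))"
      using diff_int[OF bc] by blast
    have "(\<lambda>\<xi>. ?I \<xi> *\<^sub>R (g \<xi> - fourier_integral f \<xi>)) =
        (\<lambda>\<xi>. (?I \<xi> *\<^sub>R fourier_integral (F n) \<xi> - ?I \<xi> *\<^sub>R fourier_integral f \<xi>) - ?I \<xi> *\<^sub>R (fourier_integral (F n) \<xi> - g \<xi>))" for n
      by (auto simp: algebra_simps)
    note split = this
    show int: "integrable lebesgue (\<lambda>\<xi>. ?I \<xi> *\<^sub>R (g \<xi> - fourier_integral f \<xi>))"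
      unfolding split[of n0] by (intro Bochner_Integration.integrable_diff trunc Fi f n0) simp
    define A where "A n = (\<integral>\<^sup>+x. ennreal (norm (F n x - f x) * norm (test_kernel b c x)) \<partial>lebesgue)" for n
    define B where "B n = (\<integral>\<^sup>+\<xi>. ennreal (norm (fourier_integral (F n) \<xi> - g \<xi>) * ?I \<xi>) \<partial>lebesgue)" for n
    have "ennreal (norm (LINT \<xi>|lebesgue. ?I \<xi> *\<^sub>R (g \<xi> - fourier_integral f \<xi>))) \<le> A n + B n" if n: "n \<ge> n0" for n
    proof -
      have tk: "integrable lebesgue (\<lambda>x. k x * test_kernel b c x)" if k: "integrable lebesgue k" for k :: "real \<Rightarrow> complex"
      proof (rule Bochner_Integration.integrable_bound[where f="\<lambda>x. norm (k x) * (c - b)"])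
        have [measurable]: "k \<in> borel_measurable lebesgue" using k by auto
        show "(\<lambda>x. k x * test_kernel b c x) \<in> borel_measurable lebesgue" by (rule borel_measurable_times) measurable
        show "integrable lebesgue (\<lambda>x. norm (k x) * (c - b))" using k by auto
        show "AE x in lebesgue. norm (k x * test_kernel b c x) \<le> norm (norm (k x) * (c - b))"
          using norm_test_kernel_le[OF bc] bc by (auto simp: norm_mult intro!: mult_left_mono)
      qed
      have leb: "(LINT \<xi>|lebesgue. ?I \<xi> *\<^sub>R fourier_integral k \<xi>) = (LINT x|lebesgue. k x * test_kernel b c x)"
        if k: "integrable lebesgue k" for k
      proof -
        have [measurable]: "fourier_integral k \<in> borel_measurable borel" by (rule borel_measurable_fourier_integral[OF k])
        have "(LINT \<xi>|lebesgue. ?I \<xi> *\<^sub>R fourier_integral k \<xi>) = (LINT \<xi>|lborel. ?I \<xi> *\<^sub>R fourier_integral k \<xi>)"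
          by (rule integral_completion) measurable
        then show ?thesis by (simp only: fourier_integral_test[OF k])
      qed
      have "(LINT \<xi>|lebesgue. ?I \<xi> *\<^sub>R (g \<xi> - fourier_integral f \<xi>))
          = (LINT \<xi>|lebesgue. ?I \<xi> *\<^sub>R fourier_integral (F n) \<xi>) - (LINT \<xi>|lebesgue. ?I \<xi> *\<^sub>R fourier_integral f \<xi>)
            - (LINT \<xi>|lebesgue. ?I \<xi> *\<^sub>R (fourier_integral (F n) \<xi> - g \<xi>))"
        unfolding split[of n] using trunc[OF Fi, of b c n] trunc[OF f, of b c] n0[OF n]
        by (simp only: Bochner_Integration.integral_diff Bochner_Integration.integrable_diff)
      also have "\<dots> = (LINT x|lebesgue. (F n x - f x) * test_kernel b c x)
            - (LINT \<xi>|lebesgue. ?I \<xi> *\<^sub>R (fourier_integral (F n) \<xi> - g \<xi>))"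
        by (simp only: leb[OF Fi] leb[OF f] left_diff_distrib Bochner_Integration.integral_diff[OF tk[OF Fi] tk[OF f]])
      finally have "norm (LINT \<xi>|lebesgue. ?I \<xi> *\<^sub>R (g \<xi> - fourier_integral f \<xi>))
         \<le> norm (LINT x|lebesgue. (F n x - f x) * test_kernel b c x)
            + norm (LINT \<xi>|lebesgue. ?I \<xi> *\<^sub>R (fourier_integral (F n) \<xi> - g \<xi>))"
        by (simp only: norm_triangle_ineq4)
      then have "ennreal (norm (LINT \<xi>|lebesgue. ?I \<xi> *\<^sub>R (g \<xi> - fourier_integral f \<xi>)))
         \<le> ennreal (norm (LINT x|lebesgue. (F n x - f x) * test_kernel b c x))
            + ennreal (norm (LINT \<xi>|lebesgue. ?I \<xi> *\<^sub>R (fourier_integral (F n) \<xi> - g \<xi>)))"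
        by (simp add: ennreal_plus[symmetric] ennreal_leI del: ennreal_plus)
      also have "\<dots> \<le> A n + B n"
      proof (rule add_mono)
        have "ennreal (norm (LINT x|lebesgue. (F n x - f x) * test_kernel b c x))
            \<le> (\<integral>\<^sup>+x. ennreal (norm ((F n x - f x) * test_kernel b c x)) \<partial>lebesgue)"
          by (intro integral_norm_bound_ennreal tk Bochner_Integration.integrable_diff Fi f)
        then show "ennreal (norm (LINT x|lebesgue. (F n x - f x) * test_kernel b c x)) \<le> A n"
          by (simp only: A_def norm_mult)
        have "ennreal (norm (LINT \<xi>|lebesgue. ?I \<xi> *\<^sub>R (fourier_integral (F n) \<xi> - g \<xi>)))
            \<le> (\<integral>\<^sup>+\<xi>. ennreal (norm (?I \<xi> *\<^sub>R (fourier_integral (F n) \<xi> - g \<xi>))) \<partial>lebesgue)"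
          by (intro integral_norm_bound_ennreal n0 n)
        then show "ennreal (norm (LINT \<xi>|lebesgue. ?I \<xi> *\<^sub>R (fourier_integral (F n) \<xi> - g \<xi>))) \<le> B n"
          by (simp add: B_def mult.commute)
      qed
      finally show ?thesis .
    qed
    moreover have "(\<lambda>n. A n + B n) \<longlonglongrightarrow> 0 + 0"
      unfolding A_def B_def by (intro tendsto_add phys freq bc)
    ultimately have "ennreal (norm (LINT \<xi>|lebesgue. ?I \<xi> *\<^sub>R (g \<xi> - fourier_integral f \<xi>))) \<le> 0 + 0"
      by (intro tendsto_lowerbound[where f="\<lambda>n. A n + B n" and F=sequentially]) (auto simp: eventually_sequentially)
    then show "(LINT \<xi>|lebesgue. ?I \<xi> *\<^sub>R (g \<xi> - fourier_integral f \<xi>)) = 0"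
      by simp
  qed
  then show ?thesis by simp
qed

lemma is_fourier_Lp_fourier_integral:
  assumes f: "integrable lebesgue f"
  shows "is_fourier_Lp 1 f (fourier_integral f)"
  unfolding is_fourier_Lp_def
proof (intro conjI exI[of _ "\<lambda>_. f"] allI)
  show "fourier_integral f \<in> borel_measurable lebesgue"
    using borel_measurable_fourier_integral[OF f] by (auto intro: measurable_completion)
  show "Lp_tendsto (ereal 1) (\<lambda>_. f) f" by (simp add: Lp_tendsto_def)
  show "Lp_tendsto (conjugate_exponent 1) (\<lambda>_. fourier_integral f) (fourier_integral f)"
    by (simp add: Lp_tendsto_def conjugate_exponent_def esssup_const zero_ereal_def)
qed (use f in \<open>auto simp: Lp_space_1_iff\<close>)

lemma fourier_transform_eq_fourier_integral:
  assumes f: "integrable lebesgue f"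
  shows "AE \<xi> in lebesgue. fourier_transform f \<xi> = fourier_integral f \<xi>"
    and "fourier_transform f \<in> borel_measurable lebesgue"
proof -
  have "\<exists>p\<in>{1..2}. is_fourier_Lp p f (fourier_integral f)"
    using is_fourier_Lp_fourier_integral[OF f] by (intro bexI[of _ 1]) auto
  then have "\<exists>p\<in>{1..2}. is_fourier_Lp p f (fourier_transform f)"
    unfolding fourier_transform_def by (rule someI_ex[of "\<lambda>g. \<exists>p\<in>{1..2}. is_fourier_Lp p f g", OF exI])
  then show "AE \<xi> in lebesgue. fourier_transform f \<xi> = fourier_integral f \<xi>"
    "fourier_transform f \<in> borel_measurable lebesgue"
    using fourier_Lp_unique[OF f] unfolding is_fourier_Lp_def by blast+
qed

section \<open>The propagator and the transport of a wave packet\<close>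

definition symbol :: "real \<Rightarrow> real \<Rightarrow> real \<Rightarrow> real \<Rightarrow> real \<Rightarrow> complex" where
  "symbol a \<gamma> t x \<xi> = iexp (x * \<xi>) * iexp (t * \<bar>\<xi>\<bar> powr a) * complex_of_real (exp (- (t powr \<gamma>) * \<bar>\<xi>\<bar> powr a))"

text \<open>The operator \<open>landau_schroedinger\<close> with the Fourier transform as an argument in place of the function, so that
explicit transforms can be inserted.\<close>

definition evolution :: "real \<Rightarrow> real \<Rightarrow> real \<Rightarrow> (real \<Rightarrow> complex) \<Rightarrow> real \<Rightarrow> complex" where
  "evolution a \<gamma> t g x = 1 / (2 * complex_of_real pi) * (LINT \<xi>|lborel. g \<xi> * symbol a \<gamma> t x \<xi>)"

lemma borel_measurable_symbol [measurable]: "symbol a \<gamma> t x \<in> borel_measurable borel"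
  unfolding symbol_def[abs_def] by measurable

lemma norm_symbol: "norm (symbol a \<gamma> t x \<xi>) = exp (- (t powr \<gamma>) * \<bar>\<xi>\<bar> powr a)"
  by (simp add: symbol_def norm_mult)

lemma norm_symbol_le_1: "norm (symbol a \<gamma> t x \<xi>) \<le> 1"
  by (simp add: norm_symbol)

lemma landau_schroedinger_eq_evolution:
  assumes f: "integrable lebesgue f"
  shows "landau_schroedinger a \<gamma> t f x = evolution a \<gamma> t (fourier_integral f) x"
proof -
  have [measurable]: "fourier_integral f \<in> borel_measurable borel" by (rule borel_measurable_fourier_integral[OF f])
  have [measurable]: "fourier_integral f \<in> borel_measurable lebesgue" "symbol a \<gamma> t x \<in> borel_measurable lebesgue"
    by (intro measurable_completion, measurable)+
  have [measurable]: "fourier_transform f \<in> borel_measurable lebesgue" by (rule fourier_transform_eq_fourier_integral[OF f])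
  have "landau_schroedinger a \<gamma> t f x = 1 / (2 * complex_of_real pi) * (LINT \<xi>|lebesgue. fourier_transform f \<xi> * symbol a \<gamma> t x \<xi>)"
    by (simp add: landau_schroedinger_def symbol_def mult_ac)
  also have "(LINT \<xi>|lebesgue. fourier_transform f \<xi> * symbol a \<gamma> t x \<xi>) = (LINT \<xi>|lebesgue. fourier_integral f \<xi> * symbol a \<gamma> t x \<xi>)"
    using fourier_transform_eq_fourier_integral(1)[OF f] by (intro integral_cong_AE) auto
  also have "\<dots> = (LINT \<xi>|lborel. fourier_integral f \<xi> * symbol a \<gamma> t x \<xi>)"
    by (intro integral_completion) measurable
  finally show ?thesis by (simp add: evolution_def)
qed

lemma norm_iexp_diff_le: "norm (iexp u - iexp v) \<le> \<bar>u - v\<bar>"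
proof -
  have "iexp u - iexp v = iexp v * (iexp (u - v) - 1)"
    by (simp add: algebra_simps flip: exp_add)
  then have "norm (iexp u - iexp v) = norm (iexp (u - v) - 1)" by (simp add: norm_mult)
  also have "\<dots> \<le> \<bar>u - v\<bar>" using iexp_approx1[of "u - v" 0] by simp
  finally show ?thesis .
qed

text \<open>The constant depends on \<open>a\<close> alone. On \<open>[1/2, 3/2]\<close> the exponent \<open>a - 2\<close> of the second derivative may have
either sign, so \<open>u powr (a - 2)\<close> is bounded through \<open>\<bar>ln u\<bar> \<le> ln 2\<close>.\<close>

lemma powr_Taylor_at_1:
  fixes a :: real
  obtains C where "C \<ge> 0" "\<And>z. \<bar>z - 1\<bar> \<le> 1/2 \<Longrightarrow> \<bar>z powr a - 1 - a * (z - 1)\<bar> \<le> C * (z - 1)\<^sup>2"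
proof
  let ?C = "\<bar>a * (a - 1)\<bar> * exp (\<bar>a - 2\<bar> * ln 2)"
  show "?C \<ge> 0" by simp
  fix z :: real assume z: "\<bar>z - 1\<bar> \<le> 1/2"
  then have z': "1/2 \<le> z" "z \<le> 3/2" by linarith+
  show "\<bar>z powr a - 1 - a * (z - 1)\<bar> \<le> ?C * (z - 1)\<^sup>2"
  proof (cases "z = 1")
    case False
    define diff where "diff k u = (if k = 0 then u powr a else if k = 1 then a * u powr (a - 1)
      else a * (a - 1) * u powr (a - 2))" for k :: nat and u :: real
    have D: "((diff k) has_real_derivative diff (Suc k) u) (at u)" if "k < 2" "1/2 \<le> u" for k u
    proof -
      from that consider "k = 0" | "k = 1" by linarith
      then show ?thesis
      proof cases
        case 1
        then show ?thesis using that unfolding diff_def[abs_def]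
          by (auto intro!: derivative_eq_intros)
      next
        case 2
        then show ?thesis using that unfolding diff_def[abs_def]
          by (auto intro!: derivative_eq_intros simp: mult_ac)
      qed
    qed
    have d0: "diff 0 = (\<lambda>u. u powr a)" by (simp add: diff_def fun_eq_iff)
    have "\<exists>u. (if z < 1 then z < u \<and> u < 1 else 1 < u \<and> u < z) \<and>
        z powr a = (\<Sum>k<2. diff k 1 / fact k * (z - 1) ^ k) + diff 2 u / fact 2 * (z - 1) ^ 2"
      using z' False D d0 by (intro Taylor[where a="1/2" and b="3/2"]) auto
    then obtain u where u: "if z < 1 then z < u \<and> u < 1 else 1 < u \<and> u < z"
      and eq: "z powr a = (\<Sum>k<2. diff k 1 / fact k * (z - 1) ^ k) + diff 2 u / fact 2 * (z - 1) ^ 2" by blast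
    have u': "1/2 \<le> u" "u \<le> 2" using u z' by (auto split: if_splits)
    have "\<bar>ln u\<bar> \<le> ln 2"
      using u' ln_le_cancel_iff[of "1/2" u] ln_le_cancel_iff[of u 2] by (simp add: ln_div abs_le_iff)
    then have "\<bar>(a - 2) * ln u\<bar> \<le> \<bar>a - 2\<bar> * ln 2" by (simp add: abs_mult mult_left_mono)
    then have "u powr (a - 2) \<le> exp (\<bar>a - 2\<bar> * ln 2)" using u' by (simp add: powr_def)
    then have "\<bar>a * (a - 1)\<bar> * u powr (a - 2) \<le> ?C" by (intro mult_left_mono) auto
    moreover have "0 \<le> \<bar>a * (a - 1)\<bar> * u powr (a - 2)" by simp
    ultimately have C: "\<bar>a * (a - 1)\<bar> * u powr (a - 2) / 2 \<le> ?C" by linarith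
    have "z powr a - 1 - a * (z - 1) = a * (a - 1) * u powr (a - 2) / 2 * (z - 1)\<^sup>2"
      unfolding eq by (simp add: diff_def numeral_2_eq_2)
    then have "\<bar>z powr a - 1 - a * (z - 1)\<bar> = \<bar>a * (a - 1) * u powr (a - 2) / 2 * (z - 1)\<^sup>2\<bar>"
      by (rule arg_cong)
    also have "\<dots> = \<bar>a * (a - 1)\<bar> * u powr (a - 2) / 2 * (z - 1)\<^sup>2"
      by (simp add: abs_mult)
    also have "\<dots> \<le> ?C * (z - 1)\<^sup>2" using C by (rule mult_right_mono) simp
    finally show ?thesis .
  qed simp
qed

lemma powr_Taylor_scaled:
  fixes a :: real
  obtains C where "C \<ge> 0" "\<And>N \<xi>. N > 0 \<Longrightarrow> \<bar>\<xi> - N\<bar> \<le> N/2 \<Longrightarrow>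
      \<bar>\<bar>\<xi>\<bar> powr a - (N powr a + a * N powr (a - 1) * (\<xi> - N))\<bar> \<le> C * N powr (a - 2) * (\<xi> - N)\<^sup>2"
proof -
  obtain C where C: "C \<ge> 0" "\<And>z. \<bar>z - 1\<bar> \<le> 1/2 \<Longrightarrow> \<bar>z powr a - 1 - a * (z - 1)\<bar> \<le> C * (z - 1)\<^sup>2"
    using powr_Taylor_at_1[of a] by blast
  show ?thesis
  proof
    show "C \<ge> 0" by fact
    fix N \<xi> :: real assume N: "N > 0" and \<xi>: "\<bar>\<xi> - N\<bar> \<le> N/2"
    define z where "z = \<xi> / N"
    have \<xi>z: "\<xi> = N * z" using N by (simp add: z_def)
    have z1: "\<bar>z - 1\<bar> \<le> 1/2"
    proof -
      have "\<xi> - N = N * (z - 1)" by (simp add: \<xi>z algebra_simps)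
      then have "\<bar>\<xi> - N\<bar> = N * \<bar>z - 1\<bar>" using N by (simp add: abs_mult)
      with \<xi> N show ?thesis by (simp add: field_simps)
    qed
    then have z: "z > 0" by linarith
    have p1: "N powr (a - 1) * N = N powr a" using N powr_add[of N "a - 1" 1] by simp
    have p2: "N powr (a - 2) * N\<^sup>2 = N powr a" using N powr_add[of N "a - 2" 2] by (simp add: powr_numeral)
    have "\<bar>\<xi>\<bar> powr a - (N powr a + a * N powr (a - 1) * (\<xi> - N))
        = N powr a * z powr a - N powr a - a * (N powr (a - 1) * N) * (z - 1)"
      using N z by (simp add: \<xi>z abs_mult powr_mult algebra_simps)
    also have "\<dots> = N powr a * (z powr a - 1 - a * (z - 1))" unfolding p1 by (simp add: algebra_simps)
    finally have "\<bar>\<bar>\<xi>\<bar> powr a - (N powr a + a * N powr (a - 1) * (\<xi> - N))\<bar> = N powr a * \<bar>z powr a - 1 - a * (z - 1)\<bar>"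
      by (simp add: abs_mult)
    also have "\<dots> \<le> N powr a * (C * (z - 1)\<^sup>2)" using C(2)[OF z1] by (intro mult_left_mono) auto
    also have "\<dots> = C * N powr (a - 2) * (N\<^sup>2 * (z - 1)\<^sup>2)" by (simp add: p2[symmetric])
    also have "N\<^sup>2 * (z - 1)\<^sup>2 = (\<xi> - N)\<^sup>2" by (simp add: \<xi>z power_mult_distrib[symmetric] algebra_simps)
    finally show "\<bar>\<bar>\<xi>\<bar> powr a - (N powr a + a * N powr (a - 1) * (\<xi> - N))\<bar> \<le> C * N powr (a - 2) * (\<xi> - N)\<^sup>2" .
  qed
qed

text \<open>Near \<open>N\<close> the error consists of the loss by the damping, at most \<open>t\<^sup>\<gamma> \<bar>\<xi>\<bar>\<^sup>a\<close>, and of \<open>t\<close> times the Taylor remainder of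
the phase. For \<open>\<bar>\<xi> - N\<bar> > N/2\<close> the difference of two numbers of modulus at most 1 is at most
\<open>2 \<le> 8 (\<xi> - N)\<^sup>2 / N\<^sup>2\<close>. The result is a quadratic bound on the whole line, which can be
integrated against a Gaussian without splitting the integral.\<close>

lemma symbol_linearization:
  fixes a \<gamma> :: real
  assumes a: "a > 0"
    and C: "C \<ge> 0" "\<And>\<xi>. \<bar>\<xi> - N\<bar> \<le> N/2 \<Longrightarrow>
      \<bar>\<bar>\<xi>\<bar> powr a - (N powr a + a * N powr (a - 1) * (\<xi> - N))\<bar> \<le> C * N powr (a - 2) * (\<xi> - N)\<^sup>2"
    and N: "N > 0" and t: "t > 0"
  shows "norm (symbol a \<gamma> t x \<xi> - iexp (x * \<xi> + t * (N powr a + a * N powr (a - 1) * (\<xi> - N))))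
    \<le> t powr \<gamma> * (3/2 * N) powr a + (C * t * N powr (a - 2) + 8 / N\<^sup>2) * (\<xi> - N)\<^sup>2"
proof -
  define A where "A = \<bar>\<xi>\<bar> powr a"
  define B where "B = N powr a + a * N powr (a - 1) * (\<xi> - N)"
  define \<rho> where "\<rho> = exp (- (t powr \<gamma>) * A)"
  have \<rho>: "0 \<le> \<rho>" "\<rho> \<le> 1" by (auto simp: \<rho>_def A_def)
  have eq: "symbol a \<gamma> t x \<xi> - iexp (x * \<xi> + t * B) = iexp (x * \<xi>) * (iexp (t * A) * of_real (\<rho> - 1) + (iexp (t * A) - iexp (t * B)))"
    by (simp add: symbol_def A_def \<rho>_def algebra_simps exp_add)
  have "norm (symbol a \<gamma> t x \<xi> - iexp (x * \<xi> + t * B)) = norm (iexp (t * A) * of_real (\<rho> - 1) + (iexp (t * A) - iexp (t * B)))"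
    unfolding eq by (simp add: norm_mult)
  also have "\<dots> \<le> norm (iexp (t * A) * complex_of_real (\<rho> - 1)) + norm (iexp (t * A) - iexp (t * B))"
    by (rule norm_triangle_ineq)
  also have "norm (iexp (t * A) * complex_of_real (\<rho> - 1)) = 1 - \<rho>" using \<rho> by (simp add: norm_mult del: of_real_diff)
  finally have 1: "norm (symbol a \<gamma> t x \<xi> - iexp (x * \<xi> + t * B)) \<le> (1 - \<rho>) + norm (iexp (t * A) - iexp (t * B))" .
  show ?thesis
  proof (cases "\<bar>\<xi> - N\<bar> \<le> N/2")
    case True
    have "1 - \<rho> \<le> t powr \<gamma> * A" unfolding \<rho>_def using exp_ge_add_one_self[of "- (t powr \<gamma>) * A"] by simp
    also have "\<bar>\<xi>\<bar> \<le> 3/2 * N" using True N by linarith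
    then have "A \<le> (3/2 * N) powr a" unfolding A_def using a by (intro powr_mono2) auto
    finally have 2: "1 - \<rho> \<le> t powr \<gamma> * (3/2 * N) powr a" by (simp add: mult_left_mono)
    have "norm (iexp (t * A) - iexp (t * B)) \<le> \<bar>t * A - t * B\<bar>" by (rule norm_iexp_diff_le)
    also have "\<dots> = t * \<bar>A - B\<bar>" using t by (simp add: abs_mult flip: right_diff_distrib)
    also have "\<dots> \<le> t * (C * N powr (a - 2) * (\<xi> - N)\<^sup>2)" using C(2)[OF True] t unfolding A_def B_def by (intro mult_left_mono) auto
    also have "\<dots> \<le> (C * t * N powr (a - 2) + 8 / N\<^sup>2) * (\<xi> - N)\<^sup>2" by (simp add: algebra_simps)
    finally show ?thesis using 1 2 unfolding B_def by linarith
  next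
    case False
    then have "(N/2)\<^sup>2 \<le> \<bar>\<xi> - N\<bar>\<^sup>2" using N by (intro power_mono) auto
    then have "2 \<le> 8 / N\<^sup>2 * (\<xi> - N)\<^sup>2" using N by (simp add: field_simps)
    also have "\<dots> \<le> (C * t * N powr (a - 2) + 8 / N\<^sup>2) * (\<xi> - N)\<^sup>2" using C(1) t by (intro mult_right_mono) auto
    finally have 2: "2 \<le> (C * t * N powr (a - 2) + 8 / N\<^sup>2) * (\<xi> - N)\<^sup>2" .
    have "norm (symbol a \<gamma> t x \<xi> - iexp (x * \<xi> + t * B)) \<le> norm (symbol a \<gamma> t x \<xi>) + norm (iexp (x * \<xi> + t * B))"
      by (rule norm_triangle_ineq4)
    also have "\<dots> \<le> 1 + 1" by (intro add_mono norm_symbol_le_1) simp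
    finally have "norm (symbol a \<gamma> t x \<xi> - iexp (x * \<xi> + t * B)) \<le> 2" by simp
    moreover have "0 \<le> t powr \<gamma> * (3/2 * N) powr a" by simp
    ultimately show ?thesis using 2 unfolding B_def by linarith
  qed
qed

abbreviation gauss :: "real \<Rightarrow> real \<Rightarrow> real" where
  "gauss \<nu> \<xi> \<equiv> std_normal_density (\<xi> - \<nu>)"

lemma gauss_translate:
  fixes f :: "real \<Rightarrow> complex"
  shows "(LINT \<xi>|lborel. gauss \<nu> \<xi> *\<^sub>R f \<xi>) = (LINT \<xi>|lborel. std_normal_density \<xi> *\<^sub>R f (\<nu> + \<xi>))"
  by (subst lborel_integral_real_affine[where c=1 and t=\<nu>]) auto

lemma integrable_gauss: "integrable lborel (gauss \<nu>)"
  using lborel_integrable_real_affine[OF integrable_std_normal_moment[of 0], of 1 "-\<nu>"] by simp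

lemma integral_gauss: "(LINT \<xi>|lborel. gauss \<nu> \<xi>) = 1"
  using lborel_integral_real_affine[of 1 "gauss \<nu>" \<nu>] integral_std_normal_moment_even[of 0] by simp

lemma gauss_second_moment:
  shows "integrable lborel (\<lambda>\<xi>. gauss \<nu> \<xi> * (\<xi> - N)\<^sup>2)"
    and "(LINT \<xi>|lborel. gauss \<nu> \<xi> * (\<xi> - N)\<^sup>2) = 1 + (\<nu> - N)\<^sup>2"
proof -
  let ?d = "std_normal_density"
  have eq: "?d \<xi> * (\<nu> + \<xi> - N)\<^sup>2 = ?d \<xi> * \<xi>^2 + (2 * (\<nu> - N) * (?d \<xi> * \<xi>^1) + (\<nu> - N)\<^sup>2 * (?d \<xi> * \<xi>^0))" for \<xi>
    by (simp add: power2_eq_square algebra_simps)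
  note i = integrable_std_normal_moment
  have int: "integrable lborel (\<lambda>\<xi>. ?d \<xi> * (\<nu> + \<xi> - N)\<^sup>2)"
    unfolding eq by (intro Bochner_Integration.integrable_add integrable_mult_right i)
  then show "integrable lborel (\<lambda>\<xi>. gauss \<nu> \<xi> * (\<xi> - N)\<^sup>2)"
    using lborel_integrable_real_affine_iff[of 1 "\<lambda>\<xi>. gauss \<nu> \<xi> * (\<xi> - N)\<^sup>2" \<nu>] by simp
  have "(LINT \<xi>|lborel. gauss \<nu> \<xi> * (\<xi> - N)\<^sup>2) = (LINT \<xi>|lborel. ?d \<xi> * (\<nu> + \<xi> - N)\<^sup>2)"
    by (subst lborel_integral_real_affine[where c=1 and t=\<nu>]) auto
  also have "\<dots> = (LINT \<xi>|lborel. ?d \<xi> * \<xi>^2) + (2 * (\<nu> - N) * (LINT \<xi>|lborel. ?d \<xi> * \<xi>^1) + (\<nu> - N)\<^sup>2 * (LINT \<xi>|lborel. ?d \<xi> * \<xi>^0))"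
    unfolding eq using i[of 2] i[of 1] i[of 0]
    by (simp only: Bochner_Integration.integral_add Bochner_Integration.integrable_add integrable_mult_right integral_mult_right_zero)
  also have "\<dots> = 1 + (\<nu> - N)\<^sup>2"
    using integral_std_normal_moment_even[of 1] integral_std_normal_moment_even[of 0] integral_std_normal_moment_odd[of 0]
    by (simp add: fact_numeral)
  finally show "(LINT \<xi>|lborel. gauss \<nu> \<xi> * (\<xi> - N)\<^sup>2) = 1 + (\<nu> - N)\<^sup>2" .
qed

lemma integrable_gauss_mult:
  fixes g :: "real \<Rightarrow> complex"
  assumes [measurable]: "g \<in> borel_measurable borel" and g: "\<And>\<xi>. norm (g \<xi>) \<le> 1"
  shows "integrable lborel (\<lambda>\<xi>. gauss \<nu> \<xi> *\<^sub>R g \<xi>)"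
proof (rule Bochner_Integration.integrable_bound[OF integrable_gauss[of \<nu>]])
  show "AE \<xi> in lborel. norm (gauss \<nu> \<xi> *\<^sub>R g \<xi>) \<le> norm (gauss \<nu> \<xi>)"
    using g by (auto intro!: mult_left_le)
qed measurable

lemma gauss_characteristic:
  "(LINT \<xi>|lborel. gauss \<nu> \<xi> *\<^sub>R iexp (y * \<xi>)) = iexp (y * \<nu>) * complex_of_real (exp (- y\<^sup>2 / 2))"
proof -
  have "(LINT \<xi>|lborel. gauss \<nu> \<xi> *\<^sub>R iexp (y * \<xi>)) = (LINT \<xi>|lborel. iexp (y * \<nu>) * (std_normal_density \<xi> *\<^sub>R iexp (y * \<xi>)))"
    by (subst gauss_translate) (auto simp: algebra_simps exp_add intro!: Bochner_Integration.integral_cong)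
  also have "\<dots> = iexp (y * \<nu>) * (LINT \<xi>|lborel. std_normal_density \<xi> *\<^sub>R iexp (y * \<xi>))"
    by (rule integral_mult_right_zero)
  also have "(LINT \<xi>|lborel. std_normal_density \<xi> *\<^sub>R iexp (y * \<xi>)) = char std_normal_distribution y"
    unfolding char_def by (subst integral_density) auto
  finally show ?thesis by (simp add: char_std_normal_distribution)
qed

text \<open>The linearized phase acts by a unimodular factor and the translation by \<open>y = t a N\<^sup>a\<^sup>-\<^sup>1\<close>, and
\<open>gauss_characteristic\<close> evaluates the translated packet. The error is the quadratic bound of
\<open>symbol_linearization\<close> averaged over a Gaussian centred at \<open>\<nu>\<close>.\<close>

lemma packet_transport:
  fixes a \<gamma> :: real
  assumes a: "a > 0"
    and C: "C \<ge> 0" "\<And>\<xi>. \<bar>\<xi> - N\<bar> \<le> N/2 \<Longrightarrow>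
      \<bar>\<bar>\<xi>\<bar> powr a - (N powr a + a * N powr (a - 1) * (\<xi> - N))\<bar> \<le> C * N powr (a - 2) * (\<xi> - N)\<^sup>2"
    and N: "N > 0" and t: "t > 0"
  defines "y \<equiv> t * a * N powr (a - 1)"
  shows "norm ((LINT \<xi>|lborel. gauss \<nu> \<xi> *\<^sub>R symbol a \<gamma> t x \<xi>)
      - iexp (t * N powr a - y * N) * (iexp ((x + y) * \<nu>) * complex_of_real (exp (- (x + y)\<^sup>2 / 2))))
    \<le> t powr \<gamma> * (3/2 * N) powr a + (C * t * N powr (a - 2) + 8 / N\<^sup>2) * (1 + (\<nu> - N)\<^sup>2)"
proof -
  let ?l = "\<lambda>\<xi>. iexp (x * \<xi> + t * (N powr a + a * N powr (a - 1) * (\<xi> - N)))"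
  let ?A = "t powr \<gamma> * (3/2 * N) powr a" and ?B = "C * t * N powr (a - 2) + 8 / N\<^sup>2"
  have l: "?l \<xi> = iexp (t * N powr a - y * N) * iexp ((x + y) * \<xi>)" for \<xi>
    unfolding exp_add[symmetric] by (intro arg_cong[where f=exp]) (simp add: y_def algebra_simps)
  have "(LINT \<xi>|lborel. gauss \<nu> \<xi> *\<^sub>R ?l \<xi>) = iexp (t * N powr a - y * N) * (LINT \<xi>|lborel. gauss \<nu> \<xi> *\<^sub>R iexp ((x + y) * \<xi>))"
    unfolding l by (subst integral_mult_right_zero[symmetric]) (simp add: mult_ac)
  then have main: "iexp (t * N powr a - y * N) * (iexp ((x + y) * \<nu>) * complex_of_real (exp (- (x + y)\<^sup>2 / 2))) = (LINT \<xi>|lborel. gauss \<nu> \<xi> *\<^sub>R ?l \<xi>)"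
    by (simp only: gauss_characteristic)
  have i1: "integrable lborel (\<lambda>\<xi>. gauss \<nu> \<xi> *\<^sub>R symbol a \<gamma> t x \<xi>)"
    by (intro integrable_gauss_mult norm_symbol_le_1) measurable
  have i2: "integrable lborel (\<lambda>\<xi>. gauss \<nu> \<xi> *\<^sub>R ?l \<xi>)"
    by (intro integrable_gauss_mult) auto
  have "norm ((LINT \<xi>|lborel. gauss \<nu> \<xi> *\<^sub>R symbol a \<gamma> t x \<xi>) - (LINT \<xi>|lborel. gauss \<nu> \<xi> *\<^sub>R ?l \<xi>))
      = norm (LINT \<xi>|lborel. gauss \<nu> \<xi> *\<^sub>R (symbol a \<gamma> t x \<xi> - ?l \<xi>))"
    unfolding scaleR_diff_right by (subst Bochner_Integration.integral_diff[OF i1 i2]) simp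
  also have "\<dots> \<le> (LINT \<xi>|lborel. norm (gauss \<nu> \<xi> *\<^sub>R (symbol a \<gamma> t x \<xi> - ?l \<xi>)))"
    by (rule integral_norm_bound)
  also have "\<dots> \<le> (LINT \<xi>|lborel. ?A * gauss \<nu> \<xi> + ?B * (gauss \<nu> \<xi> * (\<xi> - N)\<^sup>2))"
  proof (rule integral_mono)
    show "integrable lborel (\<lambda>\<xi>. norm (gauss \<nu> \<xi> *\<^sub>R (symbol a \<gamma> t x \<xi> - ?l \<xi>)))"
      unfolding scaleR_diff_right by (intro integrable_norm Bochner_Integration.integrable_diff i1 i2)
    show "integrable lborel (\<lambda>\<xi>. ?A * gauss \<nu> \<xi> + ?B * (gauss \<nu> \<xi> * (\<xi> - N)\<^sup>2))"
      by (intro Bochner_Integration.integrable_add integrable_mult_right integrable_gauss gauss_second_moment)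
    fix \<xi>
    have "norm (gauss \<nu> \<xi> *\<^sub>R (symbol a \<gamma> t x \<xi> - ?l \<xi>)) = gauss \<nu> \<xi> * norm (symbol a \<gamma> t x \<xi> - ?l \<xi>)"
      unfolding norm_scaleR by simp
    also have "\<dots> \<le> gauss \<nu> \<xi> * (?A + ?B * (\<xi> - N)\<^sup>2)"
      by (intro mult_left_mono symbol_linearization[OF a C N t] normal_density_nonneg)
    also have "\<dots> = ?A * gauss \<nu> \<xi> + ?B * (gauss \<nu> \<xi> * (\<xi> - N)\<^sup>2)"
      by (simp only: algebra_simps)
    finally show "norm (gauss \<nu> \<xi> *\<^sub>R (symbol a \<gamma> t x \<xi> - ?l \<xi>)) \<le> ?A * gauss \<nu> \<xi> + ?B * (gauss \<nu> \<xi> * (\<xi> - N)\<^sup>2)" .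
  qed
  also have "\<dots> = ?A * (LINT \<xi>|lborel. gauss \<nu> \<xi>) + ?B * (LINT \<xi>|lborel. gauss \<nu> \<xi> * (\<xi> - N)\<^sup>2)"
    by (rule trans[OF Bochner_Integration.integral_add arg_cong2[where f="(+)", OF integral_mult_right_zero integral_mult_right_zero]])
      (intro integrable_mult_right integrable_gauss gauss_second_moment(1))+
  also have "\<dots> = ?A + ?B * (1 + (\<nu> - N)\<^sup>2)"
    by (simp only: integral_gauss gauss_second_moment(2) mult_1_right)
  finally show ?thesis unfolding main .
qed

section \<open>Trains of spikes\<close>

text \<open>A carrier wave \<open>iexp (N * x)\<close> times the normalized Dirichlet kernel of period \<open>2\<pi>/q\<close> times a Gaussian. Its
modulus equals the Gaussian at the points of \<open>(2\<pi>/q) \<int>\<close> and, for large \<open>m\<close>, is much smaller at most other points.\<close>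

definition comb :: "nat \<Rightarrow> real \<Rightarrow> real \<Rightarrow> real \<Rightarrow> complex" where
  "comb m N q x = (\<Sum>k<m. iexp ((N + real k * q) * x)) / of_nat m * complex_of_real (exp (- x\<^sup>2 / 2))"

lemma gaussian_eq: "exp (- x\<^sup>2 / 2) = sqrt (2 * pi) * std_normal_density x"
  by (simp add: std_normal_density_def)

lemma gaussian_integral:
  "integrable lborel (\<lambda>x. complex_of_real (exp (- x\<^sup>2 / 2)) * iexp (y * x))"
  "(LINT x|lborel. complex_of_real (exp (- x\<^sup>2 / 2)) * iexp (y * x)) = of_real (sqrt (2 * pi) * exp (- y\<^sup>2 / 2))"
proof -
  have eq: "complex_of_real (exp (- x\<^sup>2 / 2)) * iexp (y * x) = of_real (sqrt (2 * pi)) * (gauss 0 x *\<^sub>R iexp (y * x))" for x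
    by (simp only: gaussian_eq diff_zero scaleR_conv_of_real of_real_mult mult.assoc)
  show "integrable lborel (\<lambda>x. complex_of_real (exp (- x\<^sup>2 / 2)) * iexp (y * x))"
    unfolding eq by (intro integrable_mult_right integrable_gauss_mult) auto
  have "(LINT x|lborel. complex_of_real (exp (- x\<^sup>2 / 2)) * iexp (y * x)) = of_real (sqrt (2 * pi)) * (LINT x|lborel. gauss 0 x *\<^sub>R iexp (y * x))"
    unfolding eq by (rule integral_mult_right_zero)
  also have "\<dots> = of_real (sqrt (2 * pi) * exp (- y\<^sup>2 / 2))"
    unfolding gauss_characteristic by simp
  finally show "(LINT x|lborel. complex_of_real (exp (- x\<^sup>2 / 2)) * iexp (y * x)) = of_real (sqrt (2 * pi) * exp (- y\<^sup>2 / 2))" .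
qed

lemma comb_eq: "comb m N q x = (\<Sum>k<m. (complex_of_real (exp (- x\<^sup>2 / 2)) * iexp ((N + real k * q) * x)) / of_nat m)"
  by (simp add: comb_def sum_distrib_left sum_divide_distrib mult_ac)

lemma borel_measurable_comb [measurable]: "comb m N q \<in> borel_measurable borel"
  unfolding comb_def[abs_def] by measurable

lemma norm_comb_le_1: "norm (comb m N q x) \<le> 1"
proof (cases "m = 0")
  case False
  have "norm (\<Sum>k<m. iexp ((N + real k * q) * x)) \<le> (\<Sum>k<m. norm (iexp ((N + real k * q) * x)))"
    by (rule norm_sum)
  also have "\<dots> = real m" by simp
  finally have "norm (\<Sum>k<m. iexp ((N + real k * q) * x)) / real m \<le> 1" using False by (simp add: divide_le_eq)
  moreover have "exp (- x\<^sup>2 / 2) \<le> 1" by simp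
  ultimately have "norm (\<Sum>k<m. iexp ((N + real k * q) * x)) / real m * exp (- x\<^sup>2 / 2) \<le> 1 * 1"
    by (intro mult_mono) auto
  then show ?thesis by (simp add: comb_def norm_mult norm_divide)
qed (simp add: comb_def)

lemma integrable_comb: "integrable lborel (comb m N q)"
  unfolding comb_eq[abs_def]
  by (intro Bochner_Integration.integrable_sum integrable_divide gaussian_integral)

lemma fourier_integral_comb:
  "fourier_integral (comb m N q) \<xi> = 2 * complex_of_real pi * (\<Sum>k<m. complex_of_real (gauss (N + real k * q) \<xi>) / of_nat m)"
proof -
  let ?e = "\<lambda>k x. complex_of_real (exp (- x\<^sup>2 / 2)) * iexp ((N + real k * q - \<xi>) * x)"
  have "fourier_integral (comb m N q) \<xi> = (LINT x|lborel. exp (- (\<i> * complex_of_real x * complex_of_real \<xi>)) * comb m N q x)"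
    unfolding fourier_integral_def by (rule integral_completion) measurable
  also have "\<dots> = (LINT x|lborel. (\<Sum>k<m. ?e k x / of_nat m))"
    unfolding comb_eq sum_distrib_left
    by (intro Bochner_Integration.integral_cong sum.cong refl) (simp add: algebra_simps flip: exp_add)
  also have "\<dots> = (\<Sum>k<m. (LINT x|lborel. ?e k x) / of_nat m)"
    by (subst Bochner_Integration.integral_sum) (intro integrable_divide gaussian_integral, simp)
  also have "\<dots> = (\<Sum>k<m. of_real (2 * pi * gauss (N + real k * q) \<xi>) / of_nat m)"
  proof (intro sum.cong refl arg_cong[where f="\<lambda>z. z / _"])
    fix k
    have "sqrt (2 * pi) * exp (- (N + real k * q - \<xi>)\<^sup>2 / 2) = sqrt (2 * pi) * (sqrt (2 * pi) * gauss (N + real k * q) \<xi>)"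
      using gaussian_eq[of "\<xi> - (N + real k * q)"] by (simp add: power2_commute)
    also have "\<dots> = 2 * pi * gauss (N + real k * q) \<xi>" by (simp flip: mult.assoc)
    finally show "(LINT x|lborel. ?e k x) = of_real (2 * pi * gauss (N + real k * q) \<xi>)"
      unfolding gaussian_integral by simp
  qed
  finally show ?thesis by (simp add: sum_distrib_left)
qed

lemma evolution_comb:
  "evolution a \<gamma> t (fourier_integral (comb m N q)) x
    = (\<Sum>k<m. (LINT \<xi>|lborel. gauss (N + real k * q) \<xi> *\<^sub>R symbol a \<gamma> t x \<xi>) / of_nat m)"
proof -
  have int: "integrable lborel (\<lambda>\<xi>. gauss \<nu> \<xi> *\<^sub>R symbol a \<gamma> t x \<xi>)" for \<nu>
    by (intro integrable_gauss_mult norm_symbol_le_1) measurable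
  have "(LINT \<xi>|lborel. fourier_integral (comb m N q) \<xi> * symbol a \<gamma> t x \<xi>)
      = (LINT \<xi>|lborel. 2 * complex_of_real pi * (\<Sum>k<m. gauss (N + real k * q) \<xi> *\<^sub>R symbol a \<gamma> t x \<xi> / of_nat m))"
    unfolding fourier_integral_comb
    by (intro Bochner_Integration.integral_cong refl) (simp add: sum_distrib_left sum_distrib_right scaleR_conv_of_real mult_ac)
  also have "\<dots> = 2 * complex_of_real pi * (\<Sum>k<m. (LINT \<xi>|lborel. gauss (N + real k * q) \<xi> *\<^sub>R symbol a \<gamma> t x \<xi>) / of_nat m)"
    by (subst integral_mult_right_zero, subst Bochner_Integration.integral_sum) (intro integrable_divide int, simp)
  finally show ?thesis by (simp add: evolution_def)
qed

lemma integrable_comb_symbol: "integrable lborel (\<lambda>\<xi>. fourier_integral (comb m N q) \<xi> * symbol a \<gamma> t x \<xi>)"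
proof -
  have int: "integrable lborel (\<lambda>\<xi>. gauss \<nu> \<xi> *\<^sub>R symbol a \<gamma> t x \<xi>)" for \<nu>
    by (intro integrable_gauss_mult norm_symbol_le_1) measurable
  have "(\<lambda>\<xi>. fourier_integral (comb m N q) \<xi> * symbol a \<gamma> t x \<xi>)
      = (\<lambda>\<xi>. 2 * complex_of_real pi * (\<Sum>k<m. gauss (N + real k * q) \<xi> *\<^sub>R symbol a \<gamma> t x \<xi> / of_nat m))"
    unfolding fourier_integral_comb
    by (simp add: sum_distrib_left sum_distrib_right scaleR_conv_of_real mult_ac)
  then show ?thesis
    by (simp only:) (intro integrable_mult_right Bochner_Integration.integrable_sum integrable_divide int)
qed

text \<open>The transform of the comb is \<open>2 \<pi>\<close> times a probability density, and the symbol has modulus at most 1.\<close>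

lemma norm_evolution_comb_le_1: "norm (evolution a \<gamma> t (fourier_integral (comb m N q)) x) \<le> 1"
proof -
  have "norm (LINT \<xi>|lborel. gauss \<nu> \<xi> *\<^sub>R symbol a \<gamma> t x \<xi>) \<le> 1" for \<nu>
  proof -
    have "norm (LINT \<xi>|lborel. gauss \<nu> \<xi> *\<^sub>R symbol a \<gamma> t x \<xi>) \<le> (LINT \<xi>|lborel. norm (gauss \<nu> \<xi> *\<^sub>R symbol a \<gamma> t x \<xi>))"
      by (rule integral_norm_bound)
    also have "\<dots> \<le> (LINT \<xi>|lborel. gauss \<nu> \<xi>)"
      by (intro integral_mono integrable_norm integrable_gauss_mult norm_symbol_le_1 integrable_gauss)
        (auto intro!: mult_left_le norm_symbol_le_1)
    finally show ?thesis by (simp only: integral_gauss)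
  qed
  note 1 = this
  have "norm (evolution a \<gamma> t (fourier_integral (comb m N q)) x) \<le> (\<Sum>k<m. 1 / real m)"
    unfolding evolution_comb using 1 by (intro sum_norm_le) (simp add: norm_divide divide_right_mono)
  also have "\<dots> \<le> 1" by simp
  finally show ?thesis .
qed

text \<open>The packet of frequency \<open>N + k q\<close> arrives at \<open>x\<close> with a phase that depends on \<open>k\<close> only through
\<open>(x + y) k q\<close>. When \<open>(x + y) q\<close> is a multiple of \<open>2 \<pi>\<close>, that is when a spike has reached \<open>x\<close>, all packets
are in phase and their average has the size of one of them.\<close>

lemma comb_focus:
  fixes a \<gamma> :: real
  assumes a: "a > 0"
    and C: "C \<ge> 0" "\<And>\<xi>. \<bar>\<xi> - N\<bar> \<le> N/2 \<Longrightarrow>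
      \<bar>\<bar>\<xi>\<bar> powr a - (N powr a + a * N powr (a - 1) * (\<xi> - N))\<bar> \<le> C * N powr (a - 2) * (\<xi> - N)\<^sup>2"
    and N: "N > 0" and t: "t > 0" and m: "m > 0"
    and focus: "(x + t * a * N powr (a - 1)) * q = 2 * pi * of_int j"
  shows "norm (evolution a \<gamma> t (fourier_integral (comb m N q)) x)
    \<ge> exp (- (x + t * a * N powr (a - 1))\<^sup>2 / 2)
      - (t powr \<gamma> * (3/2 * N) powr a + (C * t * N powr (a - 2) + 8 / N\<^sup>2) * (1 + (real m * q)\<^sup>2))"
proof -
  define y where "y = t * a * N powr (a - 1)"
  define G where "G = exp (- (x + y)\<^sup>2 / 2)"
  let ?A = "t powr \<gamma> * (3/2 * N) powr a" and ?B = "C * t * N powr (a - 2) + 8 / N\<^sup>2"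
  define M where "M = iexp (t * N powr a - y * N) * (iexp ((x + y) * N) * complex_of_real G)"
  have ph: "iexp ((x + y) * (N + real k * q)) = iexp ((x + y) * N)" for k
  proof -
    have "(x + y) * (N + real k * q) = (x + y) * N + real k * ((x + y) * q)" by (simp add: algebra_simps)
    also have "\<dots> = (x + y) * N + 2 * pi * of_int (int k * j)"
      using focus unfolding y_def[symmetric] by simp
    finally have eq: "(x + y) * (N + real k * q) = (x + y) * N + 2 * pi * of_int (int k * j)" .
    have "iexp (2 * pi * of_int (int k * j)) = 1"
      using exp_integer_2pi[of "of_int (int k * j)"] by (simp add: mult_ac)
    then show ?thesis unfolding eq by (simp add: distrib_left exp_add)
  qed
  have each: "norm ((LINT \<xi>|lborel. gauss (N + real k * q) \<xi> *\<^sub>R symbol a \<gamma> t x \<xi>) - M) \<le> ?A + ?B * (1 + (real m * q)\<^sup>2)"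
    if k: "k < m" for k
  proof -
    have "norm ((LINT \<xi>|lborel. gauss (N + real k * q) \<xi> *\<^sub>R symbol a \<gamma> t x \<xi>) - M) \<le> ?A + ?B * (1 + (N + real k * q - N)\<^sup>2)"
      using packet_transport[OF a C N t, of "N + real k * q" \<gamma> x] unfolding M_def G_def y_def[symmetric] ph .
    also have "\<dots> \<le> ?A + ?B * (1 + (real m * q)\<^sup>2)"
    proof (intro add_left_mono mult_left_mono)
      have "(real k)\<^sup>2 \<le> (real m)\<^sup>2" using k by simp
      then show "(N + real k * q - N)\<^sup>2 \<le> (real m * q)\<^sup>2" by (simp add: power_mult_distrib mult_right_mono)
      show "0 \<le> ?B" using C(1) t by simp
    qed
    finally show ?thesis .
  qed
  have diff: "evolution a \<gamma> t (fourier_integral (comb m N q)) x - M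
      = (\<Sum>k<m. ((LINT \<xi>|lborel. gauss (N + real k * q) \<xi> *\<^sub>R symbol a \<gamma> t x \<xi>) - M) / of_nat m)"
    using m unfolding evolution_comb by (simp add: diff_divide_distrib sum_subtractf)
  have "norm (evolution a \<gamma> t (fourier_integral (comb m N q)) x - M) \<le> (\<Sum>k<m. (?A + ?B * (1 + (real m * q)\<^sup>2)) / real m)"
    unfolding diff using each by (intro sum_norm_le) (simp add: norm_divide divide_right_mono)
  also have "\<dots> = ?A + ?B * (1 + (real m * q)\<^sup>2)" using m by simp
  finally have "norm (evolution a \<gamma> t (fourier_integral (comb m N q)) x - M) \<le> ?A + ?B * (1 + (real m * q)\<^sup>2)" .
  moreover have "norm M = G" by (simp add: M_def norm_mult G_def)
  moreover have "norm M \<le> norm (evolution a \<gamma> t (fourier_integral (comb m N q)) x) + norm (evolution a \<gamma> t (fourier_integral (comb m N q)) x - M)"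
    by (metis norm_triangle_sub norm_minus_commute)
  ultimately show ?thesis unfolding G_def y_def by linarith
qed

text \<open>Without its phase and Gaussian factor \<open>G\<close>, the comb is a Dirichlet kernel \<open>\<Phi>\<close>, and
\<open>\<integral> \<bar>\<Phi>\<bar>\<^sup>2 G\<close> can be computed. Its diagonal part is \<open>1/m\<close>, and the other part decays like a Gaussian in \<open>q\<close>.
The inequality \<open>\<bar>\<Phi>\<bar> \<le> d/2 + \<bar>\<Phi>\<bar>\<^sup>2/(2 d)\<close> turns this into a bound for \<open>\<integral> \<bar>\<Phi>\<bar> G\<close>.\<close>

lemma comb_L1_small:
  assumes d: "d > 0" and m: "m > 0"
  shows "(LINT x|lborel. norm (comb m N q x)) \<le> sqrt (2 * pi) * (d / 2 + (1 / real m + exp (- q\<^sup>2 / 2)) / (2 * d))"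
proof -
  define \<Phi> where "\<Phi> x = (\<Sum>k<m. iexp ((N + real k * q) * x)) / of_nat m" for x
  let ?G = "\<lambda>x::real. exp (- x\<^sup>2 / 2)"
  let ?e = "\<lambda>k l x. complex_of_real (?G x) * iexp ((real k - real l) * q * x)"
  have sq: "complex_of_real ((norm (\<Phi> x))\<^sup>2 * ?G x) = (\<Sum>k<m. \<Sum>l<m. ?e k l x / of_nat (m\<^sup>2))" for x
  proof -
    have "complex_of_real ((norm (\<Phi> x))\<^sup>2) = \<Phi> x * cnj (\<Phi> x)" by (rule complex_norm_square)
    also have "\<dots> = (\<Sum>k<m. iexp ((N + real k * q) * x)) * (\<Sum>l<m. cnj (iexp ((N + real l * q) * x))) / of_nat (m\<^sup>2)"
      by (simp add: \<Phi>_def cnj_sum power2_eq_square)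
    also have "\<dots> = (\<Sum>k<m. \<Sum>l<m. iexp ((N + real k * q) * x) * cnj (iexp ((N + real l * q) * x))) / of_nat (m\<^sup>2)"
      by (simp only: sum_product)
    also have "\<dots> = (\<Sum>k<m. \<Sum>l<m. iexp ((real k - real l) * q * x)) / of_nat (m\<^sup>2)"
      by (intro arg_cong[where f="\<lambda>z. z / _"] sum.cong refl) (simp add: exp_cnj algebra_simps flip: exp_add)
    finally show ?thesis by (simp add: sum_divide_distrib sum_distrib_left mult_ac)
  qed
  have int1: "integrable lborel (\<lambda>x. ?G x)"
    using integrable_norm[OF gaussian_integral(1)[of 0]] by simp
  have val1: "(LINT x|lborel. ?G x) = sqrt (2 * pi)"
    using arg_cong[OF gaussian_integral(2)[of 0], of Re] integral_complex_of_real[of lborel ?G] by simp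
  have ie: "integrable lborel (\<lambda>x. ?e k l x / of_nat (m\<^sup>2))" for k l
    by (intro integrable_divide gaussian_integral)
  have int2c: "integrable lborel (\<lambda>x. complex_of_real ((norm (\<Phi> x))\<^sup>2 * ?G x))"
    unfolding sq by (intro Bochner_Integration.integrable_sum ie)
  then have int2: "integrable lborel (\<lambda>x. (norm (\<Phi> x))\<^sup>2 * ?G x)"
    by (simp only: complex_of_real_integrable_eq)
  have "complex_of_real (LINT x|lborel. (norm (\<Phi> x))\<^sup>2 * ?G x) = (LINT x|lborel. complex_of_real ((norm (\<Phi> x))\<^sup>2 * ?G x))"
    by (rule integral_complex_of_real[symmetric])
  also have "\<dots> = (\<Sum>k<m. (LINT x|lborel. (\<Sum>l<m. ?e k l x / of_nat (m\<^sup>2))))"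
    unfolding sq by (intro Bochner_Integration.integral_sum Bochner_Integration.integrable_sum ie)
  also have "\<dots> = (\<Sum>k<m. \<Sum>l<m. (LINT x|lborel. ?e k l x / of_nat (m\<^sup>2)))"
    by (intro sum.cong refl Bochner_Integration.integral_sum ie)
  also have "\<dots> = (\<Sum>k<m. \<Sum>l<m. (LINT x|lborel. ?e k l x) / of_nat (m\<^sup>2))"
    by (intro sum.cong refl integral_divide_zero)
  also have "\<dots> = complex_of_real (\<Sum>k<m. \<Sum>l<m. sqrt (2 * pi) * exp (- ((real k - real l) * q)\<^sup>2 / 2) / real (m\<^sup>2))"
    unfolding gaussian_integral by simp
  finally have "(LINT x|lborel. (norm (\<Phi> x))\<^sup>2 * ?G x) = (\<Sum>k<m. \<Sum>l<m. sqrt (2 * pi) * exp (- ((real k - real l) * q)\<^sup>2 / 2) / real (m\<^sup>2))"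
    by (simp only: of_real_eq_iff)
  also have "\<dots> \<le> (\<Sum>k<m. \<Sum>l<m. sqrt (2 * pi) * ((if l = k then 1 else 0) + exp (- q\<^sup>2 / 2)) / real (m\<^sup>2))"
  proof (intro sum_mono divide_right_mono mult_left_mono)
    fix k l
    show "exp (- ((real k - real l) * q)\<^sup>2 / 2) \<le> (if l = k then 1 else 0) + exp (- q\<^sup>2 / 2)"
    proof (cases "l = k")
      case False
      then have "1 \<le> \<bar>real k - real l\<bar>" by linarith
      then have "1 \<le> (real k - real l)\<^sup>2" using one_le_power[of "\<bar>real k - real l\<bar>" 2] by simp
      then have "1 * q\<^sup>2 \<le> (real k - real l)\<^sup>2 * q\<^sup>2" by (intro mult_right_mono) auto
      then show ?thesis using False by (simp add: power_mult_distrib)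
    qed simp
  qed auto
  also have "\<dots> = (\<Sum>k<m. sqrt (2 * pi) * (1 + real m * exp (- q\<^sup>2 / 2)) / real (m\<^sup>2))"
    by (intro sum.cong refl) (simp add: sum.distrib flip: sum_divide_distrib sum_distrib_left)
  also have "\<dots> = sqrt (2 * pi) * (1 / real m + exp (- q\<^sup>2 / 2))"
    using m by (simp add: power2_eq_square add_divide_distrib distrib_left)
  finally have val2: "(LINT x|lborel. (norm (\<Phi> x))\<^sup>2 * ?G x) \<le> sqrt (2 * pi) * (1 / real m + exp (- q\<^sup>2 / 2))" .
  have int_split: "(LINT x|lborel. d / 2 * ?G x + 1 / (2 * d) * ((norm (\<Phi> x))\<^sup>2 * ?G x))
      = (LINT x|lborel. d / 2 * ?G x) + (LINT x|lborel. 1 / (2 * d) * ((norm (\<Phi> x))\<^sup>2 * ?G x))"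
    by (intro Bochner_Integration.integral_add integrable_mult_right int1 int2)
  have "(LINT x|lborel. norm (comb m N q x)) \<le> (LINT x|lborel. d / 2 * ?G x + 1 / (2 * d) * ((norm (\<Phi> x))\<^sup>2 * ?G x))"
  proof (rule integral_mono)
    show "integrable lborel (\<lambda>x. norm (comb m N q x))" by (intro integrable_norm integrable_comb)
    show "integrable lborel (\<lambda>x. d / 2 * ?G x + 1 / (2 * d) * ((norm (\<Phi> x))\<^sup>2 * ?G x))"
      by (intro Bochner_Integration.integrable_add integrable_mult_right int1 int2)
    fix x
    have norm_comb: "norm (comb m N q x) = norm (\<Phi> x) * ?G x"
      by (simp add: comb_def \<Phi>_def norm_mult norm_divide)
    have "2 * d * norm (\<Phi> x) \<le> d\<^sup>2 + (norm (\<Phi> x))\<^sup>2"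
      using sum_squares_bound[of d "norm (\<Phi> x)"] by simp
    then have "norm (\<Phi> x) \<le> d / 2 + 1 / (2 * d) * (norm (\<Phi> x))\<^sup>2"
      using d by (simp add: field_simps power2_eq_square)
    then have "norm (\<Phi> x) * ?G x \<le> (d / 2 + 1 / (2 * d) * (norm (\<Phi> x))\<^sup>2) * ?G x" by (rule mult_right_mono) simp
    then show "norm (comb m N q x) \<le> d / 2 * ?G x + 1 / (2 * d) * ((norm (\<Phi> x))\<^sup>2 * ?G x)"
      unfolding norm_comb by (simp add: algebra_simps)
  qed
  also have "\<dots> = d / 2 * sqrt (2 * pi) + 1 / (2 * d) * (LINT x|lborel. (norm (\<Phi> x))\<^sup>2 * ?G x)"
    unfolding int_split by (simp only: integral_mult_right_zero val1)
  also have "\<dots> \<le> d / 2 * sqrt (2 * pi) + 1 / (2 * d) * (sqrt (2 * pi) * (1 / real m + exp (- q\<^sup>2 / 2)))"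
    using val2 d by (intro add_left_mono mult_left_mono) auto
  also have "\<dots> = sqrt (2 * pi) * (d / 2 + (1 / real m + exp (- q\<^sup>2 / 2)) / (2 * d))"
    by (simp add: algebra_simps add_divide_distrib)
  finally show ?thesis .
qed

section \<open>Choice of the scales\<close>

text \<open>Here \<open>4 \<pi> / (q a N\<^sup>a\<^sup>-\<^sup>1)\<close> is the time in which a spike travels two periods. With \<open>q = N\<^sup>1\<^sup>-\<^sup>s\<close> it is a multiple of
\<open>N\<^sup>s\<^sup>-\<^sup>a\<close>; the damping exponent at this time is of order \<open>N\<close> to the power \<open>\<gamma> (s - a) + a\<close> and the dispersion error
is of order \<open>N\<^sup>-\<^sup>s\<close>. So \<open>s\<close> has to satisfy \<open>0 < s < a (1 - 1/\<gamma>)\<close>, and this is where \<open>\<gamma> > 1\<close> enters. The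
bound \<open>s \<le> 1/2\<close> makes \<open>q\<close> tend to infinity. Then all quantities have the right limits as \<open>N \<rightarrow> \<infinity>\<close>.\<close>

lemma focusing_parameters:
  fixes a \<gamma> C \<tau> \<epsilon> :: real and m :: nat
  assumes a: "a > 0" and \<gamma>: "\<gamma> > 1" and pos: "\<tau> > 0" "\<epsilon> > 0"
  obtains N q where "N > 0" "q \<ge> 4 * pi" "exp (- q\<^sup>2 / 2) \<le> \<epsilon>"
    "4 * pi / (q * (a * N powr (a - 1))) \<le> \<tau>"
    "(4 * pi / (q * (a * N powr (a - 1)))) powr \<gamma> * (3/2 * N) powr a
      + (C * (4 * pi / (q * (a * N powr (a - 1)))) * N powr (a - 2) + 8 / N\<^sup>2) * (1 + (real m * q)\<^sup>2) \<le> 1/32"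
proof -
  define s where "s = min (1/2) (a * (1 - 1/\<gamma>) / 2)"
  have pos': "0 < a * (1 - 1/\<gamma>)" using a \<gamma> by simp
  then have "0 < s" unfolding s_def min_less_iff_conj by (intro conjI half_gt_zero) simp_all
  moreover have "s \<le> 1/2" unfolding s_def by (rule min.cobounded1)
  moreover have "s \<le> a * (1 - 1/\<gamma>) / 2" unfolding s_def by (rule min.cobounded2)
  ultimately have s: "0 < s" "s \<le> 1/2" "s \<le> a * (1 - 1/\<gamma>) / 2" by auto
  have "s < K" if "s \<le> K / 2" "0 < K" for K using that by linarith
  from this[OF s(3) pos'] have s_lt: "s < a * (1 - 1/\<gamma>)" .
  then have sa: "s - a < 0"
  proof -
    have "a * (1 - 1/\<gamma>) \<le> a * 1" using a \<gamma> by (intro mult_left_mono) auto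
    with s_lt show ?thesis by simp
  qed
  have damp: "\<gamma> * (s - a) + a < 0"
  proof -
    have "\<gamma> * s < \<gamma> * (a * (1 - 1/\<gamma>))" using s_lt \<gamma> by (intro mult_strict_left_mono) auto
    also have "\<dots> = \<gamma> * a - a" using \<gamma> by (simp add: field_simps)
    finally show ?thesis by (simp add: algebra_simps)
  qed
  let ?c = "4 * pi / a"
  let ?q = "\<lambda>N::real. N powr (1 - s)"
  let ?T = "\<lambda>N::real. ?c * N powr (s - a)"
  let ?E = "\<lambda>N::real. ?c powr \<gamma> * (3/2) powr a * N powr (\<gamma> * (s - a) + a)
      + (C * ?c * N powr (s - 2) + 8 * N powr (-2) + C * ?c * (real m)\<^sup>2 * N powr (-s) + 8 * (real m)\<^sup>2 * N powr (-2 * s))"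
  have neg: "((\<lambda>N::real. N powr r) \<longlongrightarrow> 0) at_top" if "r < 0" for r
    using that by (rule tendsto_neg_powr) (rule filterlim_ident)
  have "(?T \<longlongrightarrow> ?c * 0) at_top" by (intro tendsto_intros neg sa)
  then have ev1: "eventually (\<lambda>N. ?T N < \<tau>) at_top" by (rule order_tendstoD) (use pos in simp)
  have "(?E \<longlongrightarrow> ?c powr \<gamma> * (3/2) powr a * 0 + (C * ?c * 0 + 8 * 0 + C * ?c * (real m)\<^sup>2 * 0 + 8 * (real m)\<^sup>2 * 0)) at_top"
    using s by (intro tendsto_add tendsto_mult tendsto_const neg damp) auto
  then have ev2: "eventually (\<lambda>N. ?E N < 1/32) at_top" by (rule order_tendstoD) simp
  have qlim: "filterlim ?q at_top at_top"
    using s by real_asymp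
  have ev3: "eventually (\<lambda>N. 4 * pi \<le> ?q N) at_top"
    using qlim by (simp add: filterlim_at_top)
  have "((\<lambda>q::real. exp (- q\<^sup>2 / 2)) \<longlongrightarrow> 0) at_top" by real_asymp
  from filterlim_compose[OF this qlim]
  have ev4: "eventually (\<lambda>N. exp (- (?q N)\<^sup>2 / 2) < \<epsilon>) at_top"
    by (rule order_tendstoD) (use pos in simp)
  obtain N where N: "N > 0" "?T N < \<tau>" "?E N < 1/32" "4 * pi \<le> ?q N" "exp (- (?q N)\<^sup>2 / 2) < \<epsilon>"
    using eventually_happens[OF eventually_conj[OF eventually_gt_at_top[of 0] eventually_conj[OF ev1 eventually_conj[OF ev2 eventually_conj[OF ev3 ev4]]]]]
    by auto
  have T: "4 * pi / (?q N * (a * N powr (a - 1))) = ?T N"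
  proof -
    have "?q N * N powr (a - 1) = N powr (a - s)" by (simp flip: powr_add)
    moreover have "N powr (s - a) = 1 / N powr (a - s)" using powr_minus_divide[of N "a - s"] by simp
    ultimately show ?thesis by (simp add: mult_ac)
  qed
  have E: "?T N powr \<gamma> * (3/2 * N) powr a + (C * ?T N * N powr (a - 2) + 8 / N\<^sup>2) * (1 + (real m * ?q N)\<^sup>2) = ?E N"
  proof -
    have "?T N powr \<gamma> * (3/2 * N) powr a = ?c powr \<gamma> * (3/2) powr a * (N powr ((s - a) * \<gamma>) * N powr a)"
      using N(1) a by (simp only: powr_mult powr_powr mult_ac)
    also have "N powr ((s - a) * \<gamma>) * N powr a = N powr (\<gamma> * (s - a) + a)"
      by (simp add: mult_ac add_ac flip: powr_add)
    finally have 1: "?T N powr \<gamma> * (3/2 * N) powr a = ?c powr \<gamma> * (3/2) powr a * N powr (\<gamma> * (s - a) + a)" .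
    have q2: "(?q N)\<^sup>2 = N powr (2 - 2 * s)"
      by (simp add: power2_eq_square flip: powr_add)
    have N2: "8 / N\<^sup>2 = 8 * N powr (-2)" using N(1) by (simp add: powr_minus_divide powr_numeral)
    have aux: "N powr u * N powr v = N powr w" if "u + v = w" for u v w :: real
      using that by (simp flip: powr_add)
    have "(C * ?T N * N powr (a - 2) + 8 / N\<^sup>2) * (1 + (real m * ?q N)\<^sup>2)
        = C * ?c * (N powr (s - a) * N powr (a - 2)) + 8 * N powr (-2)
          + C * ?c * (real m)\<^sup>2 * ((N powr (s - a) * N powr (a - 2)) * N powr (2 - 2 * s)) + 8 * (real m)\<^sup>2 * (N powr (-2) * N powr (2 - 2 * s))"
      unfolding N2 power_mult_distrib q2 by (simp add: algebra_simps add_divide_distrib)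
    also have "N powr (s - a) * N powr (a - 2) = N powr (s - 2)" by (rule aux) simp
    also have "N powr (s - 2) * N powr (2 - 2 * s) = N powr (-s)" by (rule aux) simp
    also have "N powr (-2) * N powr (2 - 2 * s) = N powr (-2 * s)" by (rule aux) simp
    finally show ?thesis using 1 by simp
  qed
  show ?thesis
  proof (rule that[of N "?q N"])
    show "4 * pi / (?q N * (a * N powr (a - 1))) \<le> \<tau>" unfolding T using N(2) by (rule less_imp_le)
    show "(4 * pi / (?q N * (a * N powr (a - 1)))) powr \<gamma> * (3/2 * N) powr a
      + (C * (4 * pi / (?q N * (a * N powr (a - 1)))) * N powr (a - 2) + 8 / N\<^sup>2) * (1 + (real m * ?q N)\<^sup>2) \<le> 1/32"
      unfolding T E using N(3) by (rule less_imp_le)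
  qed (use N in \<open>simp_all add: less_imp_le\<close>)
qed

text \<open>Small data with a maximal function that is large on all of \<open>[0,1]\<close>. The focusing times keep a positive
distance \<open>\<sigma>\<close> from 0: a spike is required to travel between one and two periods, instead of at most one.\<close>

lemma focusing_function:
  fixes a \<gamma> \<tau> \<epsilon> :: real
  assumes a: "a > 0" and \<gamma>: "\<gamma> > 1" and pos: "\<tau> > 0" "\<epsilon> > 0"
  obtains F \<sigma> where "0 < \<sigma>" "\<sigma> \<le> \<tau>" "F \<in> borel_measurable borel" "\<And>x. norm (F x) \<le> 1"
    "integrable lborel F" "(LINT x|lborel. norm (F x)) \<le> \<epsilon>"
    "\<And>t x. integrable lborel (\<lambda>\<xi>. fourier_integral F \<xi> * symbol a \<gamma> t x \<xi>)"
    "\<And>t x. norm (evolution a \<gamma> t (fourier_integral F) x) \<le> 1"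
    "\<And>x. x \<in> {0..1} \<Longrightarrow> \<exists>t\<in>{\<sigma>..\<tau>}. norm (evolution a \<gamma> t (fourier_integral F) x) \<ge> 1/16"
proof -
  define d where "d = \<epsilon> / sqrt (2 * pi)"
  have d: "d > 0" using pos by (simp add: d_def)
  obtain m0 :: nat where m0: "2 / d\<^sup>2 < real m0" using reals_Archimedean2 by blast
  define m where "m = m0"
  have "0 < 2 / d\<^sup>2" using d by simp
  then have "0 < real m0" using m0 by linarith
  then have m: "m > 0" by (simp add: m_def)
  have m_inv: "1 / real m \<le> d\<^sup>2 / 2" using m0 m d by (simp add: m_def field_simps)
  obtain C where C: "C \<ge> 0" "\<And>N \<xi>. N > 0 \<Longrightarrow> \<bar>\<xi> - N\<bar> \<le> N/2 \<Longrightarrow>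
      \<bar>\<bar>\<xi>\<bar> powr a - (N powr a + a * N powr (a - 1) * (\<xi> - N))\<bar> \<le> C * N powr (a - 2) * (\<xi> - N)\<^sup>2"
    using powr_Taylor_scaled[of a] by blast
  have d2: "d\<^sup>2 / 2 > 0" using d by simp
  obtain N q where N: "N > 0" and q: "q \<ge> 4 * pi" "exp (- q\<^sup>2 / 2) \<le> d\<^sup>2 / 2"
    and T: "4 * pi / (q * (a * N powr (a - 1))) \<le> \<tau>"
    and E: "(4 * pi / (q * (a * N powr (a - 1)))) powr \<gamma> * (3/2 * N) powr a
      + (C * (4 * pi / (q * (a * N powr (a - 1)))) * N powr (a - 2) + 8 / N\<^sup>2) * (1 + (real m * q)\<^sup>2) \<le> 1/32"
    using focusing_parameters[OF a \<gamma> pos(1) d2, of C m] by metis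
  define v where "v = a * N powr (a - 1)"
  have v: "v > 0" using a N by (simp add: v_def)
  define \<sigma> where "\<sigma> = 2 * pi / (q * v)"
  have q0: "q > 0" using q(1) pi_gt_zero by linarith
  have \<sigma>: "\<sigma> > 0" "2 * \<sigma> = 4 * pi / (q * v)" using v q0 by (auto simp: \<sigma>_def)
  show ?thesis
  proof
    show "0 < \<sigma>" by fact
    show "\<sigma> \<le> \<tau>" using \<sigma> T[folded v_def] by linarith
    show "comb m N q \<in> borel_measurable borel" by measurable
    show "norm (comb m N q x) \<le> 1" for x by (rule norm_comb_le_1)
    show "integrable lborel (comb m N q)" by (rule integrable_comb)
    show "integrable lborel (\<lambda>\<xi>. fourier_integral (comb m N q) \<xi> * symbol a \<gamma> t x \<xi>)" for t x
      by (rule integrable_comb_symbol)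
    show "norm (evolution a \<gamma> t (fourier_integral (comb m N q)) x) \<le> 1" for t x
      by (rule norm_evolution_comb_le_1)
    have "(LINT x|lborel. norm (comb m N q x)) \<le> sqrt (2 * pi) * (d / 2 + (1 / real m + exp (- q\<^sup>2 / 2)) / (2 * d))"
      by (rule comb_L1_small[OF d m])
    also have "\<dots> \<le> sqrt (2 * pi) * (d / 2 + (d\<^sup>2 / 2 + d\<^sup>2 / 2) / (2 * d))"
      using d m_inv q(2) by (intro mult_left_mono add_left_mono divide_right_mono add_mono) auto
    also have "\<dots> = sqrt (2 * pi) * d" using d by (simp add: power2_eq_square)
    also have "\<dots> = \<epsilon>" by (simp add: d_def)
    finally show "(LINT x|lborel. norm (comb m N q x)) \<le> \<epsilon>" .
    fix x :: real assume x: "x \<in> {0..1}"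
    \<comment> \<open>The displacement \<open>y\<close> takes a spike to \<open>x\<close>: it is the number in \<open>[2\<pi>/q, 4\<pi>/q)\<close> for which \<open>x + y\<close> is
        a multiple of the period.\<close>
    define j where "j = \<lceil>x * q / (2 * pi)\<rceil> + 1"
    define y where "y = 2 * pi * of_int j / q - x"
    have j: "x * q / (2 * pi) + 1 \<le> of_int j" "of_int j \<le> x * q / (2 * pi) + 2" unfolding j_def by linarith+
    have y_eq: "y = 2 * pi / q * (of_int j - x * q / (2 * pi))" using q0 by (simp add: y_def right_diff_distrib)
    have "2 * pi / q * 1 \<le> y" "y \<le> 2 * pi / q * 2"
      unfolding y_eq using j q0 by (intro mult_left_mono; simp)+
    then have y: "2 * pi / q \<le> y" "y \<le> 4 * pi / q" by simp_all
    define t where "t = y / v"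
    have ty: "t * a * N powr (a - 1) = y"
    proof -
      have "t * a * N powr (a - 1) = t * v" by (simp add: v_def)
      then show ?thesis using v by (simp add: t_def)
    qed
    have t: "\<sigma> \<le> t" "t \<le> 2 * \<sigma>"
      using y v q0 unfolding t_def \<sigma>(2) \<sigma>_def by (auto simp: divide_right_mono simp flip: divide_divide_eq_left)
    have t0: "t > 0" using t \<sigma> by linarith
    show "\<exists>t\<in>{\<sigma>..\<tau>}. norm (evolution a \<gamma> t (fourier_integral (comb m N q)) x) \<ge> 1/16"
    proof (rule bexI[of _ t])
      show "t \<in> {\<sigma>..\<tau>}" using t T[folded v_def] \<sigma> by auto
      have "(x + t * a * N powr (a - 1)) * q = 2 * pi * of_int j"
        unfolding ty using q0 by (simp add: y_def)
      note * = comb_focus[OF a C(1) C(2)[OF N] N t0 m this, where \<gamma>=\<gamma>, unfolded ty]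
      have "4 * pi / q \<le> 1" using q q0 by simp
      moreover have "0 < 2 * pi / q" using q0 by simp
      ultimately have xy: "0 \<le> x + y" "x + y \<le> 2" using x y by auto
      have "(x + y)\<^sup>2 \<le> 2\<^sup>2" using xy by (intro power_mono)
      then have "exp (-2) \<le> exp (- (x + y)\<^sup>2 / 2)" by simp
      moreover have "1/9 \<le> exp (-2 :: real)"
      proof -
        have "exp (2::real) = exp 1 * exp 1" by (simp flip: exp_add)
        also have "\<dots> \<le> 3 * 3" by (intro mult_mono exp_le) auto
        finally show ?thesis by (simp add: exp_minus field_simps)
      qed
      moreover have "t powr \<gamma> * (3/2 * N) powr a + (C * t * N powr (a - 2) + 8 / N\<^sup>2) * (1 + (real m * q)\<^sup>2)
          \<le> (2 * \<sigma>) powr \<gamma> * (3/2 * N) powr a + (C * (2 * \<sigma>) * N powr (a - 2) + 8 / N\<^sup>2) * (1 + (real m * q)\<^sup>2)"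
        using t t0 C(1) \<gamma> by (intro add_mono mult_right_mono powr_mono2 mult_left_mono order_refl) auto
      moreover have "\<dots> \<le> 1/32" using E[folded v_def] unfolding \<sigma>(2) .
      ultimately show "norm (evolution a \<gamma> t (fourier_integral (comb m N q)) x) \<ge> 1/16"
        using * by linarith
    qed
  qed
qed

section \<open>Smoothing at positive times\<close>

lemma power_over_fact_le_exp:
  fixes y :: real
  assumes "y \<ge> 0"
  shows "y ^ k / fact k \<le> exp y"
proof -
  have "(\<Sum>n\<in>{k}. y ^ n /\<^sub>R fact n) \<le> (\<Sum>n. y ^ n /\<^sub>R fact n)"
    using assms by (intro sum_le_suminf summable_exp_generic) auto
  then show ?thesis by (simp add: exp_def divide_inverse mult.commute)
qed

text \<open>A single term of order \<open>k \<ge> 2/a\<close> of the exponential series shows that the function decays at least like \<open>1/\<xi>\<^sup>2\<close>.\<close>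

lemma integrable_exp_neg_powr:
  fixes a c :: real
  assumes a: "a > 0" and c: "c > 0"
  shows "integrable lborel (\<lambda>\<xi>. exp (- c * \<bar>\<xi>\<bar> powr a))"
proof -
  obtain k :: nat where k: "2 / a < real k" using reals_Archimedean2 by blast
  then have k': "2 \<le> a * real k" using a by (simp add: field_simps)
  define K where "K = 2 + 2 * fact k / c ^ k"
  have K: "2 \<le> K" "2 * fact k / c ^ k \<le> K" using c by (auto simp: K_def)
  have "exp (- c * \<bar>\<xi>\<bar> powr a) \<le> K * (1 / (1 + \<xi>\<^sup>2))" for \<xi> :: real
  proof (cases "\<bar>\<xi>\<bar> \<le> 1")
    case True
    then have "\<xi>\<^sup>2 \<le> 1" by (simp add: abs_square_le_1)
    then have "1 \<le> 2 * (1 / (1 + \<xi>\<^sup>2))" by (simp add: pos_le_divide_eq add_pos_nonneg)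
    also have "\<dots> \<le> K * (1 / (1 + \<xi>\<^sup>2))" using K by (intro mult_right_mono) auto
    finally have "1 \<le> K * (1 / (1 + \<xi>\<^sup>2))" .
    moreover have "exp (- c * \<bar>\<xi>\<bar> powr a) \<le> 1" using c by simp
    ultimately show ?thesis by linarith
  next
    case False
    then have x1: "\<bar>\<xi>\<bar> > 1" by simp
    then have x2: "\<xi>\<^sup>2 \<ge> 1" using one_le_power[of "\<bar>\<xi>\<bar>" 2] by simp
    have "\<xi>\<^sup>2 = \<bar>\<xi>\<bar> powr 2" using x1 by (simp add: powr_numeral)
    also have "\<dots> \<le> \<bar>\<xi>\<bar> powr (a * real k)" using x1 k' by (intro powr_mono) auto
    also have "\<dots> = (\<bar>\<xi>\<bar> powr a) ^ k" using x1 by (simp add: powr_powr[symmetric] powr_realpow)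
    finally have "c ^ k * \<xi>\<^sup>2 / fact k \<le> (c * \<bar>\<xi>\<bar> powr a) ^ k / fact k"
      using c by (simp add: power_mult_distrib divide_right_mono)
    also have "\<dots> \<le> exp (c * \<bar>\<xi>\<bar> powr a)"
      using c by (intro power_over_fact_le_exp) simp
    finally have "c ^ k * \<xi>\<^sup>2 / fact k \<le> exp (c * \<bar>\<xi>\<bar> powr a)" .
    moreover have "0 < c ^ k * \<xi>\<^sup>2 / fact k" using c x1 by (intro divide_pos_pos mult_pos_pos) auto
    ultimately have "1 / exp (c * \<bar>\<xi>\<bar> powr a) \<le> 1 / (c ^ k * \<xi>\<^sup>2 / fact k)"
      by (intro divide_left_mono mult_pos_pos) auto
    also have "\<dots> = fact k / c ^ k * (1 / \<xi>\<^sup>2)" by simp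
    also have "\<dots> \<le> fact k / c ^ k * (2 * (1 / (1 + \<xi>\<^sup>2)))"
    proof (rule mult_left_mono)
      have "2 / (2 * \<xi>\<^sup>2) \<le> 2 / (1 + \<xi>\<^sup>2)" using x1 x2
        by (intro divide_left_mono mult_pos_pos add_pos_nonneg) auto
      then show "1 / \<xi>\<^sup>2 \<le> 2 * (1 / (1 + \<xi>\<^sup>2))" by simp
    qed (use c in simp)
    also have "\<dots> = 2 * fact k / c ^ k * (1 / (1 + \<xi>\<^sup>2))" by simp
    also have "\<dots> \<le> K * (1 / (1 + \<xi>\<^sup>2))" using K by (intro mult_right_mono) auto
    finally show ?thesis by (simp add: exp_minus divide_inverse)
  qed
  then show ?thesis
    by (intro Bochner_Integration.integrable_bound[OF integrable_mult_right[OF integrable_inverse_1_plus_square, of K]])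
      (use K in \<open>auto simp: abs_of_nonneg\<close>)
qed

definition damping_mass :: "real \<Rightarrow> real \<Rightarrow> real \<Rightarrow> real" where
  "damping_mass a \<gamma> \<sigma> = (LINT \<xi>|lborel. exp (- (\<sigma> powr \<gamma>) * \<bar>\<xi>\<bar> powr a))"

lemma damping_mass_nonneg: "damping_mass a \<gamma> \<sigma> \<ge> 0"
  unfolding damping_mass_def by (intro integral_nonneg_AE) auto

lemma damping_mass_antimono:
  assumes "a > 0" "\<gamma> > 0" "0 < \<sigma>" "\<sigma> \<le> t"
  shows "damping_mass a \<gamma> t \<le> damping_mass a \<gamma> \<sigma>"
  unfolding damping_mass_def
proof (rule integral_mono)
  show "integrable lborel (\<lambda>\<xi>. exp (- (t powr \<gamma>) * \<bar>\<xi>\<bar> powr a))" "integrable lborel (\<lambda>\<xi>. exp (- (\<sigma> powr \<gamma>) * \<bar>\<xi>\<bar> powr a))"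
    by (intro integrable_exp_neg_powr; use assms in simp)+
  fix \<xi> :: real
  have "\<sigma> powr \<gamma> \<le> t powr \<gamma>" using assms by (intro powr_mono2) auto
  then show "exp (- (t powr \<gamma>) * \<bar>\<xi>\<bar> powr a) \<le> exp (- (\<sigma> powr \<gamma>) * \<bar>\<xi>\<bar> powr a)"
    by (simp add: mult_right_mono)
qed

text \<open>At a positive time the damping makes the symbol integrable, while the Fourier integral is bounded by the
\<open>L\<^sup>1\<close> norm.\<close>

lemma evolution_L1_bound:
  assumes a: "a > 0" and t: "t > 0" and h: "integrable lebesgue h"
  shows "integrable lborel (\<lambda>\<xi>. fourier_integral h \<xi> * symbol a \<gamma> t x \<xi>)"
    and "norm (evolution a \<gamma> t (fourier_integral h) x) \<le> (LINT y|lebesgue. norm (h y)) * damping_mass a \<gamma> t"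
proof -
  let ?H = "LINT y|lebesgue. norm (h y)"
  have [measurable]: "fourier_integral h \<in> borel_measurable borel" by (rule borel_measurable_fourier_integral[OF h])
  have int: "integrable lborel (\<lambda>\<xi>. ?H * exp (- (t powr \<gamma>) * \<bar>\<xi>\<bar> powr a))"
    using t by (intro integrable_mult_right integrable_exp_neg_powr a) simp
  have H: "?H \<ge> 0" by (intro integral_nonneg_AE) auto
  have le: "norm (fourier_integral h \<xi> * symbol a \<gamma> t x \<xi>) \<le> ?H * exp (- (t powr \<gamma>) * \<bar>\<xi>\<bar> powr a)" for \<xi>
    unfolding norm_mult norm_symbol by (intro mult_right_mono norm_fourier_integral_le) simp
  show i: "integrable lborel (\<lambda>\<xi>. fourier_integral h \<xi> * symbol a \<gamma> t x \<xi>)"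
  proof (rule Bochner_Integration.integrable_bound[OF int])
    show "AE \<xi> in lborel. norm (fourier_integral h \<xi> * symbol a \<gamma> t x \<xi>) \<le> norm (?H * exp (- (t powr \<gamma>) * \<bar>\<xi>\<bar> powr a))"
      using H by (intro AE_I2 order_trans[OF le]) simp
  qed measurable
  have "norm (LINT \<xi>|lborel. fourier_integral h \<xi> * symbol a \<gamma> t x \<xi>) \<le> (LINT \<xi>|lborel. ?H * exp (- (t powr \<gamma>) * \<bar>\<xi>\<bar> powr a))"
    by (rule Bochner_Integration.integral_norm_bound_integral[OF i int le])
  also have "\<dots> = ?H * damping_mass a \<gamma> t" unfolding damping_mass_def by (rule integral_mult_right_zero)
  finally have 1: "norm (LINT \<xi>|lborel. fourier_integral h \<xi> * symbol a \<gamma> t x \<xi>) \<le> ?H * damping_mass a \<gamma> t" .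
  have "norm (evolution a \<gamma> t (fourier_integral h) x) = norm (LINT \<xi>|lborel. fourier_integral h \<xi> * symbol a \<gamma> t x \<xi>) / (2 * pi)"
    by (simp add: evolution_def norm_mult norm_divide)
  also have "\<dots> \<le> norm (LINT \<xi>|lborel. fourier_integral h \<xi> * symbol a \<gamma> t x \<xi>) / 1"
    using pi_gt3 by (intro divide_left_mono) auto
  finally show "norm (evolution a \<gamma> t (fourier_integral h) x) \<le> ?H * damping_mass a \<gamma> t" using 1 by simp
qed

section \<open>The gliding hump\<close>

text \<open>A substitute for Minkowski's inequality that suits rapidly decreasing series: if all \<open>2\<^sup>j\<^sup>+\<^sup>1 h\<^sub>j\<close> are at most \<open>R\<close>,
then \<open>\<Sum> h\<^sub>j \<le> R\<close>. This is applied to the \<open>R\<close> whose \<open>p\<close>-th power is the right-hand side.\<close>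

lemma suminf_powr_le:
  fixes h :: "nat \<Rightarrow> real"
  assumes h: "\<And>j. h j \<ge> 0" and p: "p \<ge> 1"
  shows "ennreal ((\<Sum>j. h j) powr p) \<le> (\<Sum>j. ennreal ((2 ^ Suc j * h j) powr p))"
proof (cases "(\<Sum>j. ennreal ((2 ^ Suc j * h j) powr p)) = top")
  case False
  define S where "S = (\<Sum>j. (2 ^ Suc j * h j) powr p)"
  have sm: "summable (\<lambda>j. (2 ^ Suc j * h j) powr p)"
    using False by (intro summable_suminf_not_top) auto
  have S: "(\<Sum>j. ennreal ((2 ^ Suc j * h j) powr p)) = ennreal S"
    unfolding S_def using sm by (intro suminf_ennreal2) auto
  have S0: "S \<ge> 0" unfolding S_def by (intro suminf_nonneg sm) auto
  define R where "R = S powr (1/p)"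
  have le: "h j \<le> R * (1/2) ^ Suc j" for j
  proof -
    have "(2 ^ Suc j * h j) powr p \<le> S"
      using sum_le_suminf[OF sm, of "{j}"] by (simp add: S_def)
    then have "((2 ^ Suc j * h j) powr p) powr (1/p) \<le> R"
      unfolding R_def using p by (intro powr_mono2) auto
    then have "2 ^ Suc j * h j \<le> R" using p h[of j] by (simp add: powr_powr)
    then show ?thesis by (simp add: field_simps)
  qed
  have geo: "(\<lambda>j. R * (1/2) ^ Suc j) sums (R * 1)"
    by (intro sums_mult power_half_series)
  have hs: "summable h"
    by (rule summable_comparison_test'[OF sums_summable[OF geo], of 0]) (use h le in auto)
  have "(\<Sum>j. h j) \<le> (\<Sum>j. R * (1/2) ^ Suc j)"
    by (intro suminf_le le hs sums_summable[OF geo])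
  then have "(\<Sum>j. h j) \<le> R" using sums_unique[OF geo] by simp
  then have "(\<Sum>j. h j) powr p \<le> R powr p"
    using suminf_nonneg[OF hs h] p by (intro powr_mono2) auto
  also have "\<dots> = S" using p S0 by (simp add: R_def powr_powr)
  finally show ?thesis unfolding S by (rule ennreal_leI)
qed simp

text \<open>What is required of the \<open>n\<close>-th term without regard to the other terms. The bound \<open>80000\<^sup>-\<^sup>n\<close> absorbs the weight \<open>100\<^sup>n\<close> with a power \<open>p \<le> 2\<close>
and the factor \<open>2\<^sup>n\<^sup>+\<^sup>1\<close> of \<open>suminf_powr_le\<close>, up to a factor 4, since \<open>100\<^sup>2 \<cdot> 2\<^sup>2 = 40000\<close>; the remaining
factor 2 makes the series converge.\<close>

definition focusing_stage where
  "focusing_stage a \<gamma> n s \<longleftrightarrow> (case s of (F, \<sigma>) \<Rightarrow>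
    0 < \<sigma> \<and> F \<in> borel_measurable borel \<and> (\<forall>x. norm (F x) \<le> 1) \<and> integrable lborel F \<and>
    (LINT x|lborel. norm (F x)) \<le> (1/80000) ^ n \<and>
    (\<forall>t x. integrable lborel (\<lambda>\<xi>. fourier_integral F \<xi> * symbol a \<gamma> t x \<xi>)) \<and>
    (\<forall>t x. norm (evolution a \<gamma> t (fourier_integral F) x) \<le> 1) \<and>
    (\<forall>x\<in>{0..1}. \<exists>t\<in>{\<sigma>..1 / real (Suc n)}. norm (evolution a \<gamma> t (fourier_integral F) x) \<ge> 1/16))"

text \<open>Each term is chosen after the previous one, so small in \<open>L\<^sup>1\<close> that, by
\<open>evolution_L1_bound\<close>, it is negligible at all times \<open>t \<ge> \<sigma>\<close> of the previous stage. Since \<open>\<sigma>\<close> decreases,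
this also protects the focusing times of all stages before.\<close>

lemma focusing_sequence:
  fixes a \<gamma> :: real
  assumes a: "a > 0" and \<gamma>: "\<gamma> > 1"
  obtains F :: "nat \<Rightarrow> real \<Rightarrow> complex" and \<sigma> :: "nat \<Rightarrow> real"
  where "\<And>n. focusing_stage a \<gamma> n (F n, \<sigma> n)" "\<And>n. \<sigma> (Suc n) \<le> \<sigma> n"
    "\<And>n. (LINT x|lborel. norm (F (Suc n) x)) \<le> (1/80000) ^ Suc n / (1 + damping_mass a \<gamma> (\<sigma> n))"
proof -
  define next_ok where "next_ok n s s' \<longleftrightarrow> snd s' \<le> snd s \<and>
      (LINT x|lborel. norm (fst s' x)) \<le> (1/80000) ^ Suc n / (1 + damping_mass a \<gamma> (snd s))"
    for n :: nat and s s' :: "(real \<Rightarrow> complex) \<times> real"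
  have ex: "\<exists>s. focusing_stage a \<gamma> n s \<and> snd s \<le> r \<and> (LINT x|lborel. norm (fst s x)) \<le> e"
    if r: "r > 0" and e: "e > 0" "e \<le> (1/80000) ^ n" for n r e
  proof -
    define \<tau> where "\<tau> = min r (1 / real (Suc n))"
    have \<tau>: "\<tau> > 0" "\<tau> \<le> r" "\<tau> \<le> 1 / real (Suc n)" using r by (auto simp: \<tau>_def)
    obtain F \<sigma> where F: "0 < \<sigma>" "\<sigma> \<le> \<tau>" "F \<in> borel_measurable borel" "\<And>x. norm (F x) \<le> 1"
      "integrable lborel F" "(LINT x|lborel. norm (F x)) \<le> e"
      "\<And>t x. integrable lborel (\<lambda>\<xi>. fourier_integral F \<xi> * symbol a \<gamma> t x \<xi>)"
      "\<And>t x. norm (evolution a \<gamma> t (fourier_integral F) x) \<le> 1"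
      "\<And>x. x \<in> {0..1} \<Longrightarrow> \<exists>t\<in>{\<sigma>..\<tau>}. norm (evolution a \<gamma> t (fourier_integral F) x) \<ge> 1/16"
      by (rule focusing_function[OF a \<gamma> \<tau>(1) e(1)]) (rule that)
    have "\<exists>t\<in>{\<sigma>..1 / real (Suc n)}. norm (evolution a \<gamma> t (fourier_integral F) x) \<ge> 1/16" if x: "x \<in> {0..1}" for x
    proof -
      obtain t where "t \<in> {\<sigma>..\<tau>}" "norm (evolution a \<gamma> t (fourier_integral F) x) \<ge> 1/16"
        using F(9)[OF x] by blast
      then show ?thesis using \<tau>(3) by (intro bexI[of _ t]) auto
    qed
    then have "focusing_stage a \<gamma> n (F, \<sigma>)"
      using F(1,3,4,5,7,8) order_trans[OF F(6) e(2)] unfolding focusing_stage_def prod.case by blast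
    then show ?thesis using F(2,6) \<tau>(2) by (intro exI[of _ "(F, \<sigma>)"]) auto
  qed
  have "\<exists>f. \<forall>n. focusing_stage a \<gamma> n (f n) \<and> next_ok n (f n) (f (Suc n))"
  proof (rule dependent_nat_choice)
    show "\<exists>s. focusing_stage a \<gamma> 0 s" using ex[of 1 1 0] by auto
    fix s n assume s: "focusing_stage a \<gamma> n s"
    let ?e = "(1/80000) ^ Suc n / (1 + damping_mass a \<gamma> (snd s))"
    have D: "0 \<le> damping_mass a \<gamma> (snd s)" by (rule damping_mass_nonneg)
    have "0 < ?e" using D by (intro divide_pos_pos) auto
    moreover have "?e \<le> (1/80000) ^ Suc n / 1" using D by (intro divide_left_mono) auto
    moreover have "0 < snd s" using s by (auto simp: focusing_stage_def)
    ultimately obtain s' where "focusing_stage a \<gamma> (Suc n) s'" "snd s' \<le> snd s"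
        "(LINT x|lborel. norm (fst s' x)) \<le> ?e"
      using ex[of "snd s" ?e "Suc n"] by (metis div_by_1)
    then show "\<exists>s'. focusing_stage a \<gamma> (Suc n) s' \<and> next_ok n s s'"
      unfolding next_ok_def by blast
  qed
  then obtain f where f: "\<And>n. focusing_stage a \<gamma> n (f n)" "\<And>n. next_ok n (f n) (f (Suc n))" by blast
  show ?thesis
  proof (rule that[of "fst \<circ> f" "snd \<circ> f"])
    show "focusing_stage a \<gamma> n ((fst \<circ> f) n, (snd \<circ> f) n)" for n using f(1)[of n] by simp
  qed (use f(2) in \<open>simp_all only: next_ok_def comp_apply\<close>)
qed

lemma fourier_integral_linear:
  assumes "integrable lebesgue f" "integrable lebesgue g"
  shows "fourier_integral (\<lambda>x. f x + g x) \<xi> = fourier_integral f \<xi> + fourier_integral g \<xi>"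
    and "fourier_integral (\<lambda>x. c * f x) \<xi> = c * fourier_integral f \<xi>"
proof -
  have int: "integrable lebesgue (\<lambda>x. exp (- (\<i> * complex_of_real x * complex_of_real \<xi>)) * k x)"
    if k: "integrable lebesgue k" for k
  proof (rule Bochner_Integration.integrable_bound[OF k])
    have "(\<lambda>x. exp (- (\<i> * complex_of_real x * complex_of_real \<xi>))) \<in> borel_measurable lebesgue"
      by (intro measurable_completion) measurable
    then show "(\<lambda>x. exp (- (\<i> * complex_of_real x * complex_of_real \<xi>)) * k x) \<in> borel_measurable lebesgue"
      using k by (intro borel_measurable_times) auto
  qed (simp add: norm_mult)
  show "fourier_integral (\<lambda>x. f x + g x) \<xi> = fourier_integral f \<xi> + fourier_integral g \<xi>"
    unfolding fourier_integral_def distrib_left by (intro Bochner_Integration.integral_add int assms)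
  show "fourier_integral (\<lambda>x. c * f x) \<xi> = c * fourier_integral f \<xi>"
    unfolding fourier_integral_def by (subst integral_mult_right_zero[symmetric]) (simp add: mult_ac)
qed

lemma evolution_linear:
  assumes f: "integrable lebesgue f" "integrable lborel (\<lambda>\<xi>. fourier_integral f \<xi> * symbol a \<gamma> t x \<xi>)"
    and g: "integrable lebesgue g" "integrable lborel (\<lambda>\<xi>. fourier_integral g \<xi> * symbol a \<gamma> t x \<xi>)"
  shows "evolution a \<gamma> t (fourier_integral (\<lambda>y. f y + c * g y)) x
      = evolution a \<gamma> t (fourier_integral f) x + c * evolution a \<gamma> t (fourier_integral g) x"
    and "integrable lborel (\<lambda>\<xi>. fourier_integral (\<lambda>y. f y + c * g y) \<xi> * symbol a \<gamma> t x \<xi>)"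
proof -
  have cg: "integrable lebesgue (\<lambda>y. c * g y)" using g by simp
  have eq: "fourier_integral (\<lambda>y. f y + c * g y) \<xi> * symbol a \<gamma> t x \<xi>
      = fourier_integral f \<xi> * symbol a \<gamma> t x \<xi> + c * (fourier_integral g \<xi> * symbol a \<gamma> t x \<xi>)" for \<xi>
    by (simp only: fourier_integral_linear(1)[OF f(1) cg] fourier_integral_linear(2)[OF g(1) g(1)] distrib_right mult.assoc)
  show "integrable lborel (\<lambda>\<xi>. fourier_integral (\<lambda>y. f y + c * g y) \<xi> * symbol a \<gamma> t x \<xi>)"
    unfolding eq by (intro Bochner_Integration.integrable_add integrable_mult_right f g)
  show "evolution a \<gamma> t (fourier_integral (\<lambda>y. f y + c * g y)) x
      = evolution a \<gamma> t (fourier_integral f) x + c * evolution a \<gamma> t (fourier_integral g) x"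
    unfolding evolution_def eq
      Bochner_Integration.integral_add[OF f(2) integrable_mult_right[OF g(2)]] integral_mult_right_zero
    by (simp add: distrib_left mult_ac)
qed

theorem theorem1p1:
  fixes a \<gamma> p :: real
  assumes "a > 0" and "\<gamma> > 1" and "1 \<le> p" and "p < 2"
  shows "\<exists>E f0. E \<in> sets lebesgue \<and> emeasure lebesgue E > 0 \<and> f0 \<in> Lp_space p \<and>
    (\<forall>x\<in>E. \<not> ((\<lambda>t. landau_schroedinger a \<gamma> t f0 x) \<longlongrightarrow> f0 x) (at_right 0))"
proof -
  note a = assms(1) and \<gamma> = assms(2) and p = assms(3,4)
  obtain F \<sigma> where stage: "\<And>n. focusing_stage a \<gamma> n (F n, \<sigma> n)" and dec: "\<And>n. \<sigma> (Suc n) \<le> \<sigma> n"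
    and tiny: "\<And>n. (LINT x|lborel. norm (F (Suc n) x)) \<le> (1/80000) ^ Suc n / (1 + damping_mass a \<gamma> (\<sigma> n))"
    by (rule focusing_sequence[OF a \<gamma>]) (rule that)
  have \<sigma>: "\<sigma> n > 0" and [measurable]: "F n \<in> borel_measurable borel" and F1: "norm (F n x) \<le> 1"
    and Fi: "integrable lborel (F n)" and Fs: "(LINT x|lborel. norm (F n x)) \<le> (1/80000) ^ n"
    and Fsym: "integrable lborel (\<lambda>\<xi>. fourier_integral (F n) \<xi> * symbol a \<gamma> t x \<xi>)"
    and Fev: "norm (evolution a \<gamma> t (fourier_integral (F n)) x) \<le> 1"
    and focus: "x \<in> {0..1} \<Longrightarrow> \<exists>t\<in>{\<sigma> n..1 / real (Suc n)}. norm (evolution a \<gamma> t (fourier_integral (F n)) x) \<ge> 1/16"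
    for n x t
    using stage[of n] unfolding focusing_stage_def prod.case by blast+
  define J where "J n = damping_mass a \<gamma> (\<sigma> n)" for n
  have J0: "J n \<ge> 0" for n unfolding J_def by (rule damping_mass_nonneg)
  have dec': "\<sigma> k \<le> \<sigma> n" if "n \<le> k" for n k using decseqD[OF decseq_SucI[of \<sigma>]] dec that by blast
  have Jmono: "J n \<le> J k" if "n \<le> k" for n k
    unfolding J_def using a \<gamma> \<sigma> dec'[OF that] by (intro damping_mass_antimono) auto
  define G where "G j x = complex_of_real (100 ^ j) * F j x" for j x
  define f0 where "f0 x = (\<Sum>j. G j x)" for x
  have [measurable]: "G j \<in> borel_measurable borel" for j unfolding G_def[abs_def] by measurable
  have [measurable]: "f0 \<in> borel_measurable borel" unfolding f0_def[abs_def] by measurable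
  have Gi: "integrable lborel (G j)" for j unfolding G_def[abs_def] by (intro integrable_mult_right Fi)
  have nG: "norm (G j x) = 100 ^ j * norm (F j x)" for j x by (simp add: G_def norm_mult norm_power)
  have IG: "(LINT x|lborel. norm (G j x)) = 100 ^ j * (LINT x|lborel. norm (F j x))" for j
    unfolding nG by (rule integral_mult_right_zero)
  have IG0: "0 \<le> (LINT x|lborel. norm (G j x))" for j by (intro integral_nonneg_AE) auto
  have IG1: "(LINT x|lborel. norm (G j x)) \<le> (1/2) ^ j" for j
  proof -
    have "(LINT x|lborel. norm (G j x)) \<le> 100 ^ j * (1/80000) ^ j"
      unfolding IG by (intro mult_left_mono Fs) simp
    also have "\<dots> = (1/800) ^ j" by (simp flip: power_mult_distrib)
    also have "\<dots> \<le> (1/2) ^ j" by (intro power_mono) auto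
    finally show ?thesis .
  qed
  have IG_tail: "(LINT x|lborel. norm (G (i + Suc n) x)) \<le> (1/2) ^ Suc i / (1 + J n)" for i n
  proof -
    have "(LINT x|lborel. norm (G (i + Suc n) x)) \<le> 100 ^ Suc (i + n) * ((1/80000) ^ Suc (i + n) / (1 + J (i + n)))"
      unfolding IG add_Suc_right using tiny[of "i + n", folded J_def] by (intro mult_left_mono) auto
    also have "\<dots> = (1/800) ^ Suc (i + n) / (1 + J (i + n))"
    proof -
      have "(1/800 :: real) ^ k = 100 ^ k * (1/80000) ^ k" for k by (simp flip: power_mult_distrib)
      then show ?thesis by (simp only: times_divide_eq_right)
    qed
    also have "\<dots> \<le> (1/2) ^ Suc i / (1 + J n)"
    proof (rule frac_le)
      have "(1/800) ^ Suc (i + n) \<le> (1/2 :: real) ^ Suc (i + n)" by (intro power_mono) auto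
      also have "\<dots> \<le> (1/2) ^ Suc i" by (intro power_decreasing) auto
      finally show "(1/800) ^ Suc (i + n) \<le> (1/2 :: real) ^ Suc i" .
    qed (use J0[of n] Jmono[of n "i + n"] in auto)
    finally show ?thesis .
  qed
  have sumG: "summable (\<lambda>j. LINT x|lborel. norm (G j x))"
    by (rule summable_comparison_test'[OF summable_geometric[of "1/2"], of 0]) (use IG0 IG1 in auto)
  have AEsum: "AE x in lborel. summable (\<lambda>j. norm (G j x))"
  proof -
    have "(\<integral>\<^sup>+x. (\<Sum>j. ennreal (norm (G j x))) \<partial>lborel) = (\<Sum>j. \<integral>\<^sup>+x. ennreal (norm (G j x)) \<partial>lborel)"
      by (rule nn_integral_suminf) measurable
    also have "\<dots> = (\<Sum>j. ennreal (LINT x|lborel. norm (G j x)))"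
      by (intro suminf_cong nn_integral_eq_integral integrable_norm Gi) auto
    also have "\<dots> \<noteq> \<infinity>" using sumG IG0 by (simp add: suminf_ennreal2)
    finally have "AE x in lborel. (\<Sum>j. ennreal (norm (G j x))) \<noteq> \<infinity>"
      by (intro nn_integral_PInf_AE) measurable
    then show ?thesis by eventually_elim (auto intro: summable_suminf_not_top)
  qed
  have f0i: "integrable lborel f0"
    unfolding f0_def[abs_def] by (rule integrable_suminf[OF Gi AEsum sumG])
  have leb: "integrable lebesgue k" if "integrable lborel k" for k :: "real \<Rightarrow> complex"
    using that integrable_completion[of k lborel] by auto
  note f0l = leb[OF f0i]

  \<comment> \<open>Since \<open>\<bar>F j\<bar> \<le> 1\<close> gives \<open>\<bar>F j\<bar>\<^sup>p \<le> \<bar>F j\<bar>\<close>, only the \<open>L\<^sup>1\<close> norms of the \<open>F j\<close> enter.\<close>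
  have f0_Lp: "f0 \<in> Lp_space p"
  proof -
    have pw: "(2 ^ Suc j * norm (G j x)) powr p \<le> 4 * 40000 ^ j * norm (F j x)" for j x
    proof -
      have "(2 ^ Suc j * norm (G j x)) powr p = (2 ^ Suc j * 100 ^ j) powr p * norm (F j x) powr p"
        by (simp add: nG powr_mult mult.assoc)
      also have "\<dots> \<le> (2 ^ Suc j * 100 ^ j) powr 2 * norm (F j x) powr 1"
      proof (rule mult_mono)
        have "1 \<le> (2 ^ Suc j :: real) * 100 ^ j"
          using mult_mono[of 1 "2 ^ Suc j" 1 "100 ^ j :: real"] one_le_power[of "2::real" "Suc j"] one_le_power[of "100::real" j] by simp
        then show "((2 ^ Suc j :: real) * 100 ^ j) powr p \<le> (2 ^ Suc j * 100 ^ j) powr 2"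
          using p by (intro powr_mono) auto
        show "norm (F j x) powr p \<le> norm (F j x) powr 1"
          using p F1 by (intro powr_mono') auto
      qed auto
      also have "(2 ^ Suc j * 100 ^ j :: real) powr 2 = ((2 ^ Suc j * 100 ^ j)\<^sup>2)"
        by (rule powr_numeral) simp
      also have "\<dots> = 4 * 40000 ^ j"
        by (simp add: power_mult_distrib power2_eq_square flip: power_mult_distrib)
      finally show ?thesis by simp
    qed
    have "(\<integral>\<^sup>+x. ennreal (norm (f0 x) powr p) \<partial>lborel) \<le> (\<integral>\<^sup>+x. (\<Sum>j. ennreal ((2 ^ Suc j * norm (G j x)) powr p)) \<partial>lborel)"
    proof (rule nn_integral_mono_AE, use AEsum in eventually_elim)
      case (elim x)
      have "norm (f0 x) \<le> (\<Sum>j. norm (G j x))" unfolding f0_def by (rule summable_norm[OF elim])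
      then have "ennreal (norm (f0 x) powr p) \<le> ennreal ((\<Sum>j. norm (G j x)) powr p)"
        using p by (intro ennreal_leI powr_mono2) auto
      also have "\<dots> \<le> (\<Sum>j. ennreal ((2 ^ Suc j * norm (G j x)) powr p))"
        using p by (intro suminf_powr_le) auto
      finally show ?case .
    qed
    also have "\<dots> = (\<Sum>j. \<integral>\<^sup>+x. ennreal ((2 ^ Suc j * norm (G j x)) powr p) \<partial>lborel)"
      by (rule nn_integral_suminf) measurable
    also have "\<dots> \<le> (\<Sum>j. ennreal (4 * (1/2) ^ j))"
    proof (intro suminf_le allI)
      fix j
      have "(\<integral>\<^sup>+x. ennreal ((2 ^ Suc j * norm (G j x)) powr p) \<partial>lborel) \<le> (\<integral>\<^sup>+x. ennreal (4 * 40000 ^ j * norm (F j x)) \<partial>lborel)"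
        by (intro nn_integral_mono ennreal_leI pw)
      also have "\<dots> = ennreal (LINT x|lborel. 4 * 40000 ^ j * norm (F j x))"
        by (intro nn_integral_eq_integral integrable_mult_right integrable_norm Fi) auto
      also have "(LINT x|lborel. 4 * 40000 ^ j * norm (F j x)) = 4 * 40000 ^ j * (LINT x|lborel. norm (F j x))"
        by (rule integral_mult_right_zero)
      also have "\<dots> \<le> 4 * 40000 ^ j * (1/80000) ^ j" by (intro mult_left_mono Fs) simp
      also have "\<dots> = 4 * (1/2) ^ j" by (simp flip: power_mult_distrib)
      finally show "(\<integral>\<^sup>+x. ennreal ((2 ^ Suc j * norm (G j x)) powr p) \<partial>lborel) \<le> ennreal (4 * (1/2) ^ j)"
        by (simp add: ennreal_leI)
    qed auto
    also have "\<dots> = ennreal (\<Sum>j. 4 * (1/2) ^ j)"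
      by (intro suminf_ennreal2 summable_mult summable_geometric) auto
    finally have fin: "(\<integral>\<^sup>+x. ennreal (norm (f0 x) powr p) \<partial>lborel) < \<infinity>"
      by (auto intro: le_less_trans)
    have "integrable lborel (\<lambda>x. norm (f0 x) powr p)"
      using fin by (intro integrableI_bounded) auto
    then have "integrable lebesgue (\<lambda>x. norm (f0 x) powr p)"
      using integrable_completion[of "\<lambda>x. norm (f0 x) powr p" lborel] by auto
    moreover have "f0 \<in> borel_measurable lebesgue" by (intro measurable_completion) measurable
    ultimately show ?thesis by (simp add: Lp_space_def)
  qed

  define S where "S n x = (\<Sum>j<n. G j x)" for n x
  have S_Suc: "S (Suc n) = (\<lambda>x. S n x + complex_of_real (100 ^ n) * F n x)" for n
    by (simp add: S_def G_def fun_eq_iff)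
  have Sl: "integrable lebesgue (S n)" for n
    unfolding S_def[abs_def] by (intro leb Bochner_Integration.integrable_sum Gi)
  have Ssym: "integrable lborel (\<lambda>\<xi>. fourier_integral (S n) \<xi> * symbol a \<gamma> t x \<xi>)" for n t x
  proof (induction n)
    case 0
    then show ?case by (simp add: S_def[abs_def] fourier_integral_def)
  next
    case (Suc n)
    then show ?case unfolding S_Suc by (intro evolution_linear(2) Sl leb Fi Fsym)
  qed
  have S_ev: "evolution a \<gamma> t (fourier_integral (S (Suc n))) x
      = evolution a \<gamma> t (fourier_integral (S n)) x + complex_of_real (100 ^ n) * evolution a \<gamma> t (fourier_integral (F n)) x" for n t x
    unfolding S_Suc by (intro evolution_linear(1) Sl leb Fi Fsym Ssym)
  \<comment> \<open>The sum of the earlier weights is less than \<open>100\<^sup>n / 99\<close>, compared with \<open>100\<^sup>n / 16\<close> for the \<open>n\<close>-th term.\<close>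
  have S_bound: "norm (evolution a \<gamma> t (fourier_integral (S n)) x) \<le> 100 ^ n / 99" for n t x
  proof (induction n)
    case 0
    then show ?case by (simp add: S_def[abs_def] fourier_integral_def evolution_def)
  next
    case (Suc n)
    have "norm (evolution a \<gamma> t (fourier_integral (S (Suc n))) x) \<le> 100 ^ n / 99 + 100 ^ n * 1"
      unfolding S_ev using Suc Fev[of t n x]
      by (intro order_trans[OF norm_triangle_ineq] add_mono) (auto simp: norm_mult norm_power)
    then show ?case by simp
  qed

  \<comment> \<open>The part of the series beyond the \<open>n\<close>-th term, which must not disturb the \<open>n\<close>-th focusing times.\<close>
  define h where "h n x = f0 x - S (Suc n) x" for n x
  have hi: "integrable lborel (h n)" for n
    unfolding h_def[abs_def] S_def by (intro Bochner_Integration.integrable_diff f0i Bochner_Integration.integrable_sum Gi)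
  have h_L1: "(LINT x|lebesgue. norm (h n x)) \<le> 1 / (1 + J n)" for n
  proof -
    have [measurable]: "h n \<in> borel_measurable borel" using hi[of n] by auto
    have tail: "summable (\<lambda>i. LINT x|lborel. norm (G (i + Suc n) x))"
      by (rule summable_ignore_initial_segment[OF sumG])
    have AEtail: "AE x in lborel. summable (\<lambda>i. norm (norm (G (i + Suc n) x)))"
      using AEsum
    proof eventually_elim
      case (elim x)
      then show ?case unfolding real_norm_def abs_norm_cancel by (rule summable_ignore_initial_segment)
    qed
    have Gn: "integrable lborel (\<lambda>x. norm (G (i + Suc n) x))" for i by (intro integrable_norm Gi)
    have tail': "summable (\<lambda>i. LINT x|lborel. norm (norm (G (i + Suc n) x)))" using tail by simp
    have "(LINT x|lebesgue. norm (h n x)) = (LINT x|lborel. norm (h n x))"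
      by (intro integral_completion) measurable
    also have "\<dots> \<le> (LINT x|lborel. (\<Sum>i. norm (G (i + Suc n) x)))"
    proof (rule integral_mono_AE)
      show "integrable lborel (\<lambda>x. norm (h n x))" by (intro integrable_norm hi)
      show "integrable lborel (\<lambda>x. \<Sum>i. norm (G (i + Suc n) x))"
        by (rule integrable_suminf[OF Gn AEtail tail'])
      show "AE x in lborel. norm (h n x) \<le> (\<Sum>i. norm (G (i + Suc n) x))"
        using AEsum
      proof eventually_elim
        case (elim x)
        have "h n x = (\<Sum>i. G (i + Suc n) x)"
          unfolding h_def f0_def S_def
          using suminf_minus_initial_segment[OF summable_norm_cancel[OF elim], of "Suc n"] by simp
        also have "norm \<dots> \<le> (\<Sum>i. norm (G (i + Suc n) x))"
          by (rule summable_norm[OF summable_ignore_initial_segment[OF elim]])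
        finally show ?case .
      qed
    qed
    also have "\<dots> = (\<Sum>i. LINT x|lborel. norm (G (i + Suc n) x))"
      by (rule integral_suminf[OF Gn AEtail tail'])
    also have "\<dots> \<le> (\<Sum>i. (1/2) ^ Suc i / (1 + J n))"
      by (intro suminf_le IG_tail tail summable_divide sums_summable[OF power_half_series])
    also have "\<dots> = 1 / (1 + J n)"
      using sums_unique[OF sums_divide[OF power_half_series, of "1 + J n"]] by simp
    finally show ?thesis .
  qed

  have large: "\<exists>t\<in>{\<sigma> n..1 / real (Suc n)}. norm (landau_schroedinger a \<gamma> t f0 x) \<ge> 100 ^ n / 20 - 1"
    if x: "x \<in> {0..1}" for n x
  proof -
    obtain t where t: "t \<in> {\<sigma> n..1 / real (Suc n)}" and big: "norm (evolution a \<gamma> t (fourier_integral (F n)) x) \<ge> 1/16"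
      using focus[OF x] by blast
    have t0: "t > 0" using t \<sigma>[of n] by auto
    let ?ev = "\<lambda>f. evolution a \<gamma> t (fourier_integral f) x"
    have f0_split: "f0 = (\<lambda>x. S (Suc n) x + 1 * h n x)" by (simp add: h_def)
    have "?ev f0 = ?ev (S (Suc n)) + 1 * ?ev (h n)"
      by (subst f0_split) (intro evolution_linear(1) Sl Ssym leb hi evolution_L1_bound(1)[OF a t0])
    then have ev: "?ev f0 = ?ev (S n) + complex_of_real (100 ^ n) * ?ev (F n) + ?ev (h n)"
      by (simp add: S_ev)
    have "norm (?ev (h n)) \<le> (LINT y|lebesgue. norm (h n y)) * damping_mass a \<gamma> t"
      by (intro evolution_L1_bound(2) a t0 leb hi)
    also have "\<dots> \<le> 1 / (1 + J n) * J n"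
    proof (rule mult_mono)
      show "damping_mass a \<gamma> t \<le> J n" unfolding J_def
        using a \<gamma> \<sigma> t by (intro damping_mass_antimono) auto
    qed (use h_L1 damping_mass_nonneg J0[of n] in auto)
    also have "\<dots> \<le> 1" using J0[of n] by simp
    finally have 1: "norm (?ev (h n)) \<le> 1" .
    have 2: "norm (complex_of_real (100 ^ n) * ?ev (F n)) \<ge> 100 ^ n * (1/16)"
      using big unfolding norm_mult by (intro mult_mono) (auto simp: norm_power)
    have "norm (complex_of_real (100 ^ n) * ?ev (F n)) \<le> norm (?ev f0) + norm (?ev (S n)) + norm (?ev (h n))"
    proof -
      have "complex_of_real (100 ^ n) * ?ev (F n) = (?ev f0 - ?ev (S n)) - ?ev (h n)" unfolding ev by simp
      also have "norm \<dots> \<le> norm (?ev f0 - ?ev (S n)) + norm (?ev (h n))" by (rule norm_triangle_ineq4)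
      also have "norm (?ev f0 - ?ev (S n)) \<le> norm (?ev f0) + norm (?ev (S n))" by (rule norm_triangle_ineq4)
      finally show ?thesis by simp
    qed
    with 1 2 S_bound[of t n x] have "norm (?ev f0) \<ge> 100 ^ n * (1/16) - 100 ^ n / 99 - 1" by linarith
    moreover have "(100::real) ^ n > 0" by simp
    ultimately have "norm (?ev f0) \<ge> 100 ^ n / 20 - 1" by linarith
    with t show ?thesis by (intro bexI[of _ t]) (auto simp: landau_schroedinger_eq_evolution[OF f0l])
  qed

  have "\<not> ((\<lambda>t. landau_schroedinger a \<gamma> t f0 x) \<longlongrightarrow> f0 x) (at_right 0)" if x: "x \<in> {0..1}" for x
  proof
    assume "((\<lambda>t. landau_schroedinger a \<gamma> t f0 x) \<longlongrightarrow> f0 x) (at_right 0)"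
    then have "((\<lambda>t. norm (landau_schroedinger a \<gamma> t f0 x)) \<longlongrightarrow> norm (f0 x)) (at_right 0)"
      by (rule tendsto_norm)
    then have "eventually (\<lambda>t. norm (landau_schroedinger a \<gamma> t f0 x) < norm (f0 x) + 1) (at_right 0)"
      by (rule order_tendstoD) simp
    then obtain b where b: "b > 0" "\<And>t. 0 < t \<Longrightarrow> t < b \<Longrightarrow> norm (landau_schroedinger a \<gamma> t f0 x) < norm (f0 x) + 1"
      by (auto simp: eventually_at_right_field)
    have "eventually (\<lambda>n. 1 / real (Suc n) < b) sequentially"
      by (rule order_tendstoD[OF LIMSEQ_Suc[OF lim_1_over_n]]) (use b in auto)
    moreover have "filterlim (\<lambda>n::nat. 100 ^ n / 20 - 1 :: real) at_top sequentially" by real_asymp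
    then have "eventually (\<lambda>n. norm (f0 x) + 1 \<le> 100 ^ n / 20 - 1) sequentially"
      unfolding filterlim_at_top by blast
    ultimately have "eventually (\<lambda>n. 1 / real (Suc n) < b \<and> norm (f0 x) + 1 \<le> 100 ^ n / 20 - 1) sequentially"
      by eventually_elim auto
    then obtain n where n: "1 / real (Suc n) < b" "norm (f0 x) + 1 \<le> 100 ^ n / 20 - 1"
      using eventually_happens[of _ sequentially] by auto
    obtain t where "t \<in> {\<sigma> n..1 / real (Suc n)}" "norm (landau_schroedinger a \<gamma> t f0 x) \<ge> 100 ^ n / 20 - 1"
      using large[OF x] by blast
    then show False using n b(2)[of t] \<sigma>[of n] by auto
  qed
  moreover have "emeasure lebesgue {0..1::real} > 0" by simp
  ultimately show ?thesis using f0_Lp by (intro exI[of _ "{0..1}"] exI[of _ f0]) auto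
qed

end
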